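(* Let $\beta_1,\beta_2>-1$ and let $\varrho$ be the probability measure on $[-1,1]$ given by $d\varrho(\alpha)=k\,(1-\alpha)^{\beta_1}(1+\alpha)^{\beta_2}\,d\alpha$, where $k=k(\beta_1,\beta_2)>0$ is the normalization constant. Let $f$ be analytic in an (open) ellipse in the complex plane that contains $[-1,1]$, with $f$ real-valued on $[-1,1]$. For each $N\ge1$ let $g=g_N$ be the collocation gPC approximation of $f$, i.e. the unique polynomial of degree at most $N-1$ that interpolates $f$ at the $N$ Gauss quadrature points associated with $\varrho$. Let $\mu=f_*\varrho$ and $\nu=\nu_N=(g_N)_*\varrho$. Then for every $p\ge 1$ there exist constants $C,\gamma>0$, not depending on $N$, such that for all sufficiently large $N$ $$W_p(\mu,\nu_N)\le C e^{-\gamma N}\qquad\text{and}\qquad \|F_\mu-F_{\nu_N}\|_{L^1(\mathbb{R})}\le C e^{-\gamma N}.$$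
   Context: The Gauss quadrature points associated with $\varrho$ are the $N$ distinct real roots (in $(-1,1)$) of $p_N$, where $\{p_n\}_{n\ge0}$ are the Jacobi polynomials orthonormal with respect to $\varrho$: $\deg p_n=n$ and $\int_{-1}^1p_np_m\,d\varrho=\delta_{n,m}$. The pushforward is $f_*\varrho(B)=\varrho(f^{-1}(B))$ for Borel $B\subseteq\mathbb{R}$, with $f$ and $g_N$ regarded as functions on $[-1,1]$. For a Borel probability measure $\sigma$ on $\mathbb{R}$, $F_\sigma(y)=\sigma([y,\infty))$ (the paper's convention for the CDF). For Borel probability measures $\mu,\nu$ on $\mathbb{R}$ with finite $p$-th moments, $1\le p<\infty$, $W_p(\mu,\nu)=\left[\inf_{\gamma\in\Gamma}\int_{\mathbb{R}^2}|x-y|^p\,d\gamma(x,y)\right]^{1/p}$, where $\Gamma$ is the set of Borel measures on $\mathbb{R}^2$ whose first and second marginals are $\mu$ and $\nu$. *)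

theory Defs
  imports
    "HOL-Analysis.Analysis"
    "HOL-Probability.Probability"
    "HOL-Computational_Algebra.Polynomial"
begin

definition jacobi_weight :: "real \<Rightarrow> real \<Rightarrow> real \<Rightarrow> real" where
  "jacobi_weight \<beta>\<^sub>1 \<beta>\<^sub>2 x = (1 - x) powr \<beta>\<^sub>1 * (1 + x) powr \<beta>\<^sub>2"

definition jacobi_const :: "real \<Rightarrow> real \<Rightarrow> real" where
  "jacobi_const \<beta>\<^sub>1 \<beta>\<^sub>2 = 1 / (LINT x:{-1..1}|lborel. jacobi_weight \<beta>\<^sub>1 \<beta>\<^sub>2 x)"

(* The underlying space of this measure is the interval, not the whole line.
   At the endpoints powr gives 0 for every exponent; this affects a null set only. *)
definition jacobi_measure :: "real \<Rightarrow> real \<Rightarrow> real measure" where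
  "jacobi_measure \<beta>\<^sub>1 \<beta>\<^sub>2 =
     density (restrict_space lborel {-1..1})
       (\<lambda>x. ennreal (jacobi_const \<beta>\<^sub>1 \<beta>\<^sub>2 * jacobi_weight \<beta>\<^sub>1 \<beta>\<^sub>2 x))"

lemma jacobi_weight_has_integral:
  assumes "\<beta>\<^sub>1 > -1" "\<beta>\<^sub>2 > -1"
  shows "(jacobi_weight \<beta>\<^sub>1 \<beta>\<^sub>2 has_integral
           2 powr (\<beta>\<^sub>1 + \<beta>\<^sub>2 + 1) * Beta (\<beta>\<^sub>2 + 1) (\<beta>\<^sub>1 + 1)) {-1..1}"
proof -
  have "((\<lambda>t. t powr \<beta>\<^sub>2 * (1 - t) powr \<beta>\<^sub>1) has_integral Beta (\<beta>\<^sub>2 + 1) (\<beta>\<^sub>1 + 1)) (cbox 0 1)"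
    using has_integral_Beta_real[of "\<beta>\<^sub>2 + 1" "\<beta>\<^sub>1 + 1"] assms by simp
  from has_integral_affinity'[OF this, of "1/2" "1/2"]
  have "((\<lambda>x. (x/2 + 1/2) powr \<beta>\<^sub>2 * (1/2 - x/2) powr \<beta>\<^sub>1)
          has_integral 2 * Beta (\<beta>\<^sub>2 + 1) (\<beta>\<^sub>1 + 1)) {-1..1}"
    by (simp add: algebra_simps)
  from has_integral_mult_right[OF this, of "2 powr (\<beta>\<^sub>1 + \<beta>\<^sub>2)"]
  have *: "((\<lambda>x. 2 powr (\<beta>\<^sub>1 + \<beta>\<^sub>2) * ((x/2 + 1/2) powr \<beta>\<^sub>2 * (1/2 - x/2) powr \<beta>\<^sub>1))
          has_integral 2 powr (\<beta>\<^sub>1 + \<beta>\<^sub>2 + 1) * Beta (\<beta>\<^sub>2 + 1) (\<beta>\<^sub>1 + 1)) {-1..1}"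
    by (simp add: powr_add mult_ac)
  have "2 powr (\<beta>\<^sub>1 + \<beta>\<^sub>2) * ((x/2 + 1/2) powr \<beta>\<^sub>2 * (1/2 - x/2) powr \<beta>\<^sub>1) = jacobi_weight \<beta>\<^sub>1 \<beta>\<^sub>2 x"
    if "x \<in> {-1..1}" for x
  proof -
    have "(1 + x) powr \<beta>\<^sub>2 = 2 powr \<beta>\<^sub>2 * (x/2 + 1/2) powr \<beta>\<^sub>2"
      using that powr_mult[of 2 "x/2 + 1/2" \<beta>\<^sub>2] by (simp add: algebra_simps)
    moreover have "(1 - x) powr \<beta>\<^sub>1 = 2 powr \<beta>\<^sub>1 * (1/2 - x/2) powr \<beta>\<^sub>1"
      using that powr_mult[of 2 "1/2 - x/2" \<beta>\<^sub>1] by (simp add: algebra_simps)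
    ultimately show ?thesis
      by (simp add: jacobi_weight_def powr_add mult_ac)
  qed
  with * show ?thesis
    by (rule has_integral_eq[rotated])
qed

lemma borel_measurable_jacobi_weight [measurable]:
  "jacobi_weight \<beta>\<^sub>1 \<beta>\<^sub>2 \<in> borel_measurable borel"
  unfolding jacobi_weight_def[abs_def] by measurable

lemma prob_space_jacobi_measure:
  assumes "\<beta>\<^sub>1 > -1" "\<beta>\<^sub>2 > -1"
  shows "prob_space (jacobi_measure \<beta>\<^sub>1 \<beta>\<^sub>2)"
proof -
  define I where "I = 2 powr (\<beta>\<^sub>1 + \<beta>\<^sub>2 + 1) * Beta (\<beta>\<^sub>2 + 1) (\<beta>\<^sub>1 + 1)"
  have I: "(jacobi_weight \<beta>\<^sub>1 \<beta>\<^sub>2 has_integral I) {-1..1}"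
    unfolding I_def by (rule jacobi_weight_has_integral[OF assms])
  have "Beta (\<beta>\<^sub>2 + 1) (\<beta>\<^sub>1 + 1) > 0"
    using assms by (auto simp: Beta_def intro!: divide_pos_pos mult_pos_pos Gamma_real_pos)
  hence pos: "I > 0"
    by (simp add: I_def)
  have nn: "jacobi_weight \<beta>\<^sub>1 \<beta>\<^sub>2 x \<ge> 0" for x
    by (simp add: jacobi_weight_def)
  have N: "(\<integral>\<^sup>+x. ennreal (jacobi_weight \<beta>\<^sub>1 \<beta>\<^sub>2 x) * indicator {-1..1} x \<partial>lborel) = ennreal I"
    by (rule nn_integral_has_integral_lebesgue'[OF _ I]) (rule nn)
  have "(LINT x:{-1..1}|lborel. jacobi_weight \<beta>\<^sub>1 \<beta>\<^sub>2 x) = I"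
    unfolding set_lebesgue_integral_def
  proof (subst integral_eq_nn_integral)
    have "(\<integral>\<^sup>+x. ennreal (indicator {-1..1} x *\<^sub>R jacobi_weight \<beta>\<^sub>1 \<beta>\<^sub>2 x) \<partial>lborel) = ennreal I"
      unfolding N[symmetric] by (intro nn_integral_cong) (simp split: split_indicator)
    thus "enn2real (\<integral>\<^sup>+x. ennreal (indicator {-1..1} x *\<^sub>R jacobi_weight \<beta>\<^sub>1 \<beta>\<^sub>2 x) \<partial>lborel) = I"
      using pos by simp
  qed (auto simp: nn)
  hence k: "jacobi_const \<beta>\<^sub>1 \<beta>\<^sub>2 = 1 / I"
    by (simp add: jacobi_const_def)
  have "emeasure (jacobi_measure \<beta>\<^sub>1 \<beta>\<^sub>2) (space (jacobi_measure \<beta>\<^sub>1 \<beta>\<^sub>2)) =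
          (\<integral>\<^sup>+x. ennreal (jacobi_const \<beta>\<^sub>1 \<beta>\<^sub>2 * jacobi_weight \<beta>\<^sub>1 \<beta>\<^sub>2 x)
             \<partial>restrict_space lborel {-1..1})"
    unfolding jacobi_measure_def
    by (subst emeasure_density) (auto intro!: nn_integral_cong measurable_restrict_space1 simp: sets_restrict_space_iff)
  also have "\<dots> = (\<integral>\<^sup>+x. ennreal (1 / I) * (ennreal (jacobi_weight \<beta>\<^sub>1 \<beta>\<^sub>2 x) * indicator {-1..1} x) \<partial>lborel)"
    using pos by (subst nn_integral_restrict_space)
      (auto intro!: nn_integral_cong simp: k ennreal_mult' nn divide_nonneg_pos mult.assoc simp flip: ennreal_mult
        split: split_indicator)
  also have "\<dots> = ennreal (1 / I) * ennreal I"
    by (subst nn_integral_cmult) (auto simp: N)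
  also have "\<dots> = 1"
    using pos by (simp flip: ennreal_mult)
  finally show ?thesis
    by (rule prob_spaceI)
qed

definition orthonormal_polys :: "real measure \<Rightarrow> (nat \<Rightarrow> real poly) \<Rightarrow> bool" where
  "orthonormal_polys M P \<longleftrightarrow>
     (\<forall>n. degree (P n) = n) \<and>
     (\<forall>n m. (LINT x|M. poly (P n) x * poly (P m) x) = (if n = m then 1 else 0))"

definition quadrature_points :: "(nat \<Rightarrow> real poly) \<Rightarrow> nat \<Rightarrow> real set" where
  "quadrature_points P N = {x. poly (P N) x = 0}"

(* Meant for N \<ge> 1, where the points are N distinct roots and g is therefore unique. *)
definition collocation_gPC ::
  "(nat \<Rightarrow> real poly) \<Rightarrow> (real \<Rightarrow> real) \<Rightarrow> nat \<Rightarrow> real poly \<Rightarrow> bool" where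
  "collocation_gPC P h N g \<longleftrightarrow>
     degree g \<le> N - 1 \<and> (\<forall>x\<in>quadrature_points P N. poly g x = h x)"

(* Foci a and b, major axis of length r; r > dist a b excludes degenerate ellipses. *)
definition open_ellipse :: "complex set \<Rightarrow> bool" where
  "open_ellipse E \<longleftrightarrow> (\<exists>a b r. dist a b < r \<and> E = {z. dist z a + dist z b < r})"

definition couplings :: "real measure \<Rightarrow> real measure \<Rightarrow> (real \<times> real) measure set" where
  "couplings \<mu> \<nu> =
     {\<pi>. sets \<pi> = sets borel \<and> distr \<pi> borel fst = \<mu> \<and> distr \<pi> borel snd = \<nu>}"

definition transport_cost :: "real \<Rightarrow> real measure \<Rightarrow> real measure \<Rightarrow> ennreal" where
  "transport_cost p \<mu> \<nu> =
     (INF \<pi>\<in>couplings \<mu> \<nu>. \<integral>\<^sup>+ z. ennreal (\<bar>fst z - snd z\<bar> powr p) \<partial>\<pi>)"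

(* The p-th root on ennreal, sending infinity to infinity; an infinite cost must not
   become 0 through enn2real. *)
definition wasserstein :: "real \<Rightarrow> real measure \<Rightarrow> real measure \<Rightarrow> ennreal" where
  "wasserstein p \<mu> \<nu> =
     (if transport_cost p \<mu> \<nu> = \<infinity> then \<infinity>
      else ennreal (enn2real (transport_cost p \<mu> \<nu>) powr (1 / p)))"

(* Upper tail including the endpoint, unlike the library's cdf. *)
definition upper_cdf :: "real measure \<Rightarrow> real \<Rightarrow> real" where
  "upper_cdf \<sigma> y = measure \<sigma> {y..}"

(* Valued in ennreal so that a non-integrable argument gets infinity, not 0. *)
definition L1_norm :: "(real \<Rightarrow> real) \<Rightarrow> ennreal" where
  "L1_norm h = (\<integral>\<^sup>+ y. ennreal \<bar>h y\<bar> \<partial>lborel)"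

end

theory Submission
  imports Defs "HOL-Complex_Analysis.Complex_Analysis" "HOL-Real_Asymp.Real_Asymp"
begin

text \<open>
  Both distances are bounded by the uniform distance of \<open>f\<close> and \<open>g\<^sub>N\<close> on \<open>[-1,1]\<close>: the law of
  \<open>(f, g\<^sub>N)\<close> is a coupling, and the two distribution functions are compared by Tonelli's theorem.
  Writing \<open>f\<close> as a Cauchy integral over a rectangle around \<open>[-1,1]\<close> and replacing \<open>1/(z - x)\<close> by
  \<open>(1 - T\<^sub>N(x)/T\<^sub>N(z))/(z - x)\<close>, where \<open>T\<^sub>N\<close> is the Chebyshev polynomial, gives a polynomial \<open>q\<close> of degree
  below \<open>N\<close> with geometrically small uniform error. As the Gauss rule with nonnegative weights of total
  mass 1 integrates \<open>(g\<^sub>N - q)\<^sup>2\<close> exactly, the mean square of \<open>g\<^sub>N - q\<close> is at most the square of that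
  error. Finally a Markov-type inequality bounds the maximum of a polynomial by its mean square up to
  a factor polynomial in the degree, because the Jacobi measure of an interval is at least a fixed
  power of its length.
\<close>

section \<open>Joukowski map and Chebyshev polynomials\<close>

text \<open>The two solutions of u^2 - 2zu + 1 = 0 are z + s and z - s with s^2 = z^2 - 1. Their
  product is 1, so one of them has modulus at least 1.\<close>

lemma joukowski_surj:
  fixes z :: complex
  obtains u where "norm u \<ge> 1" "z = (u + 1 / u) / 2"
proof -
  define s where "s = csqrt (z\<^sup>2 - 1)"
  have "s\<^sup>2 = z\<^sup>2 - 1"
    by (simp add: s_def)
  then have prod: "(z + s) * (z - s) = 1"
    by (simp add: algebra_simps power2_eq_square)
  then have prod': "(z - s) * (z + s) = 1"
    by (simp add: algebra_simps)
  have *: "z = (u + 1 / u) / 2" if "u * v = 1" "u + v = 2 * z" for u v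
  proof -
    have "1 / u = v"
      using that(1) by (metis mult_zero_left nonzero_mult_div_cancel_left zero_neq_one)
    then show ?thesis
      using that(2) by simp
  qed
  show thesis
  proof (cases "norm (z + s) \<ge> 1")
    case True
    then show thesis
      by (rule that) (rule *[OF prod], simp)
  next
    case False
    have "norm (z + s) * norm (z - s) = 1"
      by (metis norm_mult norm_one prod)
    with False have "norm (z - s) \<ge> 1"
      using mult_left_le_one_le[of "norm (z - s)" "norm (z + s)"] by simp
    then show thesis
      by (rule that) (rule *[OF prod'], simp)
  qed
qed

text \<open>Circles around 0 go to ellipses with foci 1 and -1. With u = v^2 the two focal distances
  are squares of |v - 1/v| and |v + 1/v|, halved, and the parallelogram law adds them up.\<close>

lemma joukowski_focal_sum:
  fixes u :: complex
  assumes "u \<noteq> 0"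
  shows "norm ((u + 1 / u) / 2 - 1) + norm ((u + 1 / u) / 2 + 1) = norm u + 1 / norm u"
proof -
  define v where "v = csqrt u"
  have v: "u = v\<^sup>2" "v \<noteq> 0"
    using assms by (auto simp: v_def)
  have "(u + 1 / u) / 2 - 1 = (v - 1 / v)\<^sup>2 / 2" "(u + 1 / u) / 2 + 1 = (v + 1 / v)\<^sup>2 / 2"
    using v by (auto simp: field_simps power2_eq_square)
  then have "norm ((u + 1 / u) / 2 - 1) + norm ((u + 1 / u) / 2 + 1) =
      ((norm (v - 1 / v))\<^sup>2 + (norm (v + 1 / v))\<^sup>2) / 2"
    by (simp only: norm_divide norm_power add_divide_distrib) simp
  also have "\<dots> = (norm v)\<^sup>2 + (norm (1 / v))\<^sup>2"
    by (simp add: cmod_power2 power2_sum power2_diff)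
  also have "\<dots> = norm u + 1 / norm u"
    using v by (simp add: norm_power norm_divide power_divide)
  finally show ?thesis .
qed

text \<open>The function t + 1/t increases on t >= 1. In this contraposed form it turns a comparison
  of focal sums into one of the moduli of Joukowski preimages.\<close>

lemma plus_inverse_mono:
  fixes R r :: real
  assumes "1 \<le> r" "r + 1 / r < R + 1 / R" "1 \<le> R"
  shows "r < R"
proof (rule ccontr)
  assume "\<not> r < R"
  then have le: "R \<le> r" by simp
  have "(r - R) * (r * R - 1) \<ge> 0"
    using le assms mult_mono[of 1 r 1 R] by (intro mult_nonneg_nonneg) auto
  then have "R + 1 / R \<le> r + 1 / r"
    using assms le by (simp add: field_simps power2_eq_square)
  with assms show False by simp
qed

text \<open>The Chebyshev polynomials of the first kind, with complex coefficients because they are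
  evaluated on a contour around [-1,1].\<close>

fun chebyshev :: "nat \<Rightarrow> complex poly" where
  "chebyshev 0 = 1"
| "chebyshev (Suc 0) = [:0, 1:]"
| "chebyshev (Suc (Suc n)) = [:0, 2:] * chebyshev (Suc n) - chebyshev n"

lemma degree_chebyshev_le: "degree (chebyshev n) \<le> n"
proof (induction n rule: chebyshev.induct)
  case (3 n)
  have "degree ([:0, 2:] * chebyshev (Suc n)) \<le> Suc (Suc n)"
    using 3 by (intro order_trans[OF degree_mult_le]) auto
  then show ?case
    using 3 by (auto intro!: degree_diff_le)
qed auto

text \<open>The complex form of T_n(cos t) = cos(nt), obtained from the three-term
  recursion.\<close>

lemma poly_chebyshev_joukowski:
  assumes "u \<noteq> 0"
  shows "poly (chebyshev n) ((u + 1 / u) / 2) = (u ^ n + 1 / u ^ n) / 2"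
proof (induction n rule: chebyshev.induct)
  case (3 n)
  then show ?case
  proof -
    let ?z = "(u + 1 / u) / 2"
    have "poly (chebyshev (Suc (Suc n))) ?z = 2 * ?z * ((u ^ Suc n + 1 / u ^ Suc n) / 2) - (u ^ n + 1 / u ^ n) / 2"
      by (simp only: chebyshev.simps poly_diff poly_mult 3) simp
    also have "\<dots> = (u ^ Suc (Suc n) + 1 / u ^ Suc (Suc n)) / 2"
      using assms by (simp add: field_simps)
    finally show ?thesis .
  qed
qed auto

text \<open>For \<open>norm u\<close> at least 1 the term u^n outweighs its inverse, whose modulus
  is at most 1. This growth off [-1,1] is the source of the geometric rate.\<close>

lemma norm_chebyshev_ge:
  assumes "norm u \<ge> R" "R \<ge> 1"
  shows "norm (poly (chebyshev n) ((u + 1 / u) / 2)) \<ge> (R ^ n - 1) / 2"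
proof -
  have u: "u \<noteq> 0" "norm u \<ge> 1"
    using assms by auto
  have "norm (1 / u ^ n) \<le> 1"
    using u by (simp add: norm_divide norm_power one_le_power)
  moreover have "R ^ n \<le> norm (u ^ n)"
    using assms by (simp add: norm_power power_mono)
  ultimately have "R ^ n - 1 \<le> norm (u ^ n) - norm (1 / u ^ n)"
    by (rule diff_mono[rotated])
  also have "\<dots> \<le> norm (u ^ n + 1 / u ^ n)"
    by (rule norm_diff_ineq)
  finally have "R ^ n - 1 \<le> norm (u ^ n + 1 / u ^ n)" .
  then show ?thesis
    unfolding poly_chebyshev_joukowski[OF u(1)] norm_divide by simp
qed

text \<open>On [-1,1] the focal sum is 2, and t + 1/t = 2 forces t = 1.\<close>

lemma joukowski_of_real:
  assumes "x \<in> {-1..1}"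
  obtains u where "norm u = 1" "complex_of_real x = (u + 1 / u) / 2"
proof -
  obtain u :: complex where u: "norm u \<ge> 1" "complex_of_real x = (u + 1 / u) / 2"
    by (rule joukowski_surj)
  have "norm (complex_of_real x - 1) + norm (complex_of_real x + 1) = 2"
    using assms by (simp add: cmod_def)
  moreover have "u \<noteq> 0" using u by auto
  ultimately have "norm u + 1 / norm u = 2"
    using joukowski_focal_sum[of u] u by simp
  then have "(norm u - 1)\<^sup>2 = 0"
    using \<open>u \<noteq> 0\<close> by (simp add: field_simps power2_eq_square)
  then have "norm u = 1" by simp
  with u that show thesis by blast
qed

lemma norm_chebyshev_of_real_le:
  assumes "x \<in> {-1..1}"
  shows "norm (poly (chebyshev n) (complex_of_real x)) \<le> 1"
proof -
  obtain u where u: "norm u = 1" "complex_of_real x = (u + 1 / u) / 2"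
    using joukowski_of_real[OF assms] .
  have "u \<noteq> 0" using u by auto
  then have "norm (poly (chebyshev n) (complex_of_real x)) = norm (u ^ n + 1 / u ^ n) / 2"
    unfolding u(2) poly_chebyshev_joukowski[OF \<open>u \<noteq> 0\<close>] norm_divide by simp
  moreover have "norm (u ^ n + 1 / u ^ n) \<le> norm (u ^ n) + norm (1 / u ^ n)"
    by (rule norm_triangle_ineq)
  moreover have "norm (u ^ n) + norm (1 / u ^ n) = 2"
    using u by (simp add: norm_divide norm_power)
  ultimately show ?thesis
    by simp
qed

text \<open>The divided difference is a polynomial in x of degree below that of \<open>p\<close>,
  with coefficients polynomial in z. Separating the variables this way lets z be integrated out term
  by term. In the induction step \<open>p\<close> itself becomes the coefficient of x^0 and the
  others move up by one.\<close>

lemma poly_divided_difference: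
  fixes p :: "'a::comm_ring_1 poly"
  shows "\<exists>c :: nat \<Rightarrow> 'a poly. \<forall>z x. poly p z - poly p x = (z - x) * (\<Sum>j<degree p. poly (c j) z * x ^ j)"
proof (induction p)
  case 0
  then show ?case by simp
next
  case (pCons a p)
  show ?case
  proof (cases "p = 0")
    case False
    obtain c where c: "\<And>z x. poly p z - poly p x = (z - x) * (\<Sum>j<degree p. poly (c j) z * x ^ j)"
      using pCons.IH by blast
    define d where "d = (\<lambda>j. case j of 0 \<Rightarrow> p | Suc i \<Rightarrow> c i)"
    have "poly (pCons a p) z - poly (pCons a p) x = (z - x) * (\<Sum>j<degree (pCons a p). poly (d j) z * x ^ j)" for z x
    proof -
      have "poly (pCons a p) z - poly (pCons a p) x = (z - x) * poly p z + x * (poly p z - poly p x)"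
        by (simp add: algebra_simps)
      also have "\<dots> = (z - x) * (poly p z + x * (\<Sum>j<degree p. poly (c j) z * x ^ j))"
        unfolding c by (simp add: algebra_simps)
      also have "poly p z + x * (\<Sum>j<degree p. poly (c j) z * x ^ j) =
          (\<Sum>j<degree (pCons a p). poly (d j) z * x ^ j)"
        using False by (simp add: sum.lessThan_Suc_shift d_def sum_distrib_left mult_ac del: sum.lessThan_Suc)
      finally show ?thesis .
    qed
    then show ?thesis by blast
  qed auto
qed

section \<open>Contour integrals over rectangles\<close>

lemma rectpath_eq_linepaths:
  "rectpath a b = linepath a (Complex (Re b) (Im a)) +++ linepath (Complex (Re b) (Im a)) b +++
     linepath b (Complex (Re a) (Im b)) +++ linepath (Complex (Re a) (Im b)) a"
  by (simp add: rectpath_def Let_def)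

lemma segments_subset_path_image_rectpath:
  "closed_segment a (Complex (Re b) (Im a)) \<subseteq> path_image (rectpath a b)"
  "closed_segment (Complex (Re b) (Im a)) b \<subseteq> path_image (rectpath a b)"
  "closed_segment b (Complex (Re a) (Im b)) \<subseteq> path_image (rectpath a b)"
  "closed_segment (Complex (Re a) (Im b)) a \<subseteq> path_image (rectpath a b)"
  by (auto simp: rectpath_eq_linepaths path_image_join)

lemma contour_integrable_linepath_rectpath:
  assumes "continuous_on (path_image (rectpath a b)) f"
    and "closed_segment s t \<subseteq> path_image (rectpath a b)"
  shows "f contour_integrable_on linepath s t"
  using assms by (intro contour_integrable_continuous_linepath) (rule continuous_on_subset)

lemma contour_integrable_continuous_rectpath:
  assumes "continuous_on (path_image (rectpath a b)) f"
  shows "f contour_integrable_on rectpath a b"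
  unfolding rectpath_eq_linepaths
  using segments_subset_path_image_rectpath[THEN contour_integrable_linepath_rectpath[OF assms]]
  by simp

lemma contour_integral_rectpath_bound:
  assumes cont: "continuous_on (path_image (rectpath a b)) f"
    and le: "Re a \<le> Re b" "Im a \<le> Im b"
    and B: "\<And>z. z \<in> path_image (rectpath a b) \<Longrightarrow> norm (f z) \<le> B"
  shows "norm (contour_integral (rectpath a b) f) \<le> 2 * B * (Re b - Re a + (Im b - Im a))"
proof -
  define c where "c = Complex (Re b) (Im a)"
  define d where "d = Complex (Re a) (Im b)"
  have "a \<in> path_image (rectpath a b)"
    using pathstart_in_path_image[of "rectpath a b"] by simp
  then have "B \<ge> 0" using B norm_ge_zero order_trans by blast
  then have N: "norm (contour_integral (linepath s t) f) \<le> B * norm (t - s)"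
    if "closed_segment s t \<subseteq> path_image (rectpath a b)" for s t
    using that B by (intro contour_integral_bound_linepath contour_integrable_linepath_rectpath[OF cont]) auto
  note sub = segments_subset_path_image_rectpath[where a = a and b = b, folded c_def d_def]
  note Is = sub[THEN contour_integrable_linepath_rectpath[OF cont]]
  have n: "norm (c - a) = Re b - Re a" "norm (b - c) = Im b - Im a" "norm (d - b) = Re b - Re a" "norm (a - d) = Im b - Im a"
    using le by (simp_all add: c_def d_def cmod_def)
  have "norm (contour_integral (rectpath a b) f) \<le>
    norm (contour_integral (linepath a c) f) + (norm (contour_integral (linepath c b) f) +
     (norm (contour_integral (linepath b d) f) + norm (contour_integral (linepath d a) f)))"
    unfolding rectpath_eq_linepaths c_def[symmetric] d_def[symmetric] using Is
    by (auto intro!: order_trans[OF norm_triangle_ineq] add_left_mono)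
  also have "\<dots> \<le> B * norm (c - a) + (B * norm (b - c) + (B * norm (d - b) + B * norm (a - d)))"
    by (intro add_mono N sub)
  also have "\<dots> = 2 * B * (Re b - Re a + (Im b - Im a))"
    unfolding n by (simp add: algebra_simps)
  finally show ?thesis .
qed

section \<open>Polynomial approximation of analytic functions\<close>

text \<open>Equality in the triangle inequality for -1, z and 1 would place z on the segment between
  the foci.\<close>

lemma focal_sum_gt_2:
  fixes z :: complex
  assumes "z \<notin> complex_of_real ` {-1..1}"
  shows "norm (z - 1) + norm (z + 1) > 2"
proof (rule ccontr)
  assume "\<not> ?thesis"
  moreover have "norm ((z + 1) - (z - 1)) \<le> norm (z + 1) + norm (z - 1)"
    by (rule norm_triangle_ineq4)
  ultimately have "norm (z - 1) + norm (z + 1) = 2"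
    by simp
  then have "dist (-1) (1::complex) = dist (-1) z + dist z 1"
    by (simp add: dist_norm norm_minus_commute add.commute)
  then have "z \<in> closed_segment (complex_of_real (-1)) (complex_of_real 1)"
    by (simp add: between flip: between_mem_segment)
  then show False
    using assms by (simp only: closed_segment_of_real) (simp add: closed_segment_eq_real_ivl)
qed

text \<open>The focal sum attains a minimum above 2 on the contour, so the Chebyshev polynomials
  grow there at least like R^n, uniformly, while they are bounded by 1 on [-1,1]. The contour is
  fixed before n, which keeps \<open>C\<close> and \<open>R\<close> independent of n.\<close>

lemma exponential_polynomial_approximation:
  fixes f :: "complex \<Rightarrow> complex"
  assumes S: "open S" "convex S" "complex_of_real ` {-1..1} \<subseteq> S" and f: "f holomorphic_on S"
  obtains C R where "C > 0" "R > 1"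
    "\<And>n. n \<ge> 1 \<Longrightarrow> \<exists>q :: real poly. degree q \<le> n - 1 \<and>
       (\<forall>x\<in>{-1..1}. \<bar>Re (f (complex_of_real x)) - poly q x\<bar> \<le> C / R ^ n)"
proof -
  let ?K = "complex_of_real ` {-1..1}"
  have "compact ?K"
    by (intro compact_continuous_image continuous_intros) auto
  then obtain d where d: "d > 0" "(\<Union>x\<in>?K. cball x d) \<subseteq> S"
    using compact_subset_open_imp_cball_epsilon_subset S by metis
  \<comment> \<open>Half of \<open>d\<close>, because a point of the closed rectangle differs by at
    most \<open>e\<close> in each coordinate from the nearest point of [-1,1].\<close>
  define e where "e = d / 2"
  define a where "a = Complex (-1 - e) (-e)"
  define b where "b = Complex (1 + e) e"
  define G where "G = rectpath a b"
  have e: "e > 0" using d by (simp add: e_def)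
  have le: "Re a \<le> Re b" "Im a \<le> Im b"
    using e by (auto simp: a_def b_def)
  have "cbox a b \<subseteq> S"
  proof
    fix z assume z: "z \<in> cbox a b"
    define x where "x = max (-1) (min 1 (Re z))"
    have "norm (of_real x - z) \<le> \<bar>Re (of_real x - z)\<bar> + \<bar>Im (of_real x - z)\<bar>"
      by (rule cmod_le)
    also have "\<dots> \<le> e + e"
      using z e by (intro add_mono) (auto simp: x_def a_def b_def in_cbox_complex_iff)
    finally have "z \<in> cball (of_real x) d"
      by (simp add: dist_norm e_def)
    moreover have "complex_of_real x \<in> ?K"
      by (auto simp: x_def)
    ultimately show "z \<in> S"
      using d by blast
  qed
  moreover have "path_image G \<subseteq> cbox a b"
    unfolding G_def by (rule path_image_rectpath_subset_cbox) (use le in auto)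
  ultimately have GS: "path_image G \<subseteq> S" by blast
  have Gbox: "z \<notin> box a b" if "z \<in> path_image G" for z
    using that le by (auto simp: G_def path_image_rectpath_cbox_minus_box)
  have dist: "norm (z - of_real x) \<ge> e" if "z \<in> path_image G" "x \<in> {-1..1}" for z x
  proof (rule ccontr)
    assume "\<not> ?thesis"
    then have "\<bar>Re (z - of_real x)\<bar> < e" "\<bar>Im (z - of_real x)\<bar> < e"
      using abs_Re_le_cmod[of "z - of_real x"] abs_Im_le_cmod[of "z - of_real x"] by linarith+
    then have "z \<in> box a b"
      using that(2) by (auto simp: a_def b_def in_box_complex_iff)
    with Gbox that show False by blast
  qed
  have cG: "compact (path_image G)"
    by (simp add: G_def compact_path_image)
  have ne: "path_image G \<noteq> {}" by simp
  have "continuous_on (path_image G) (\<lambda>z. norm (z - 1) + norm (z + 1))"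
    by (intro continuous_intros)
  from continuous_attains_inf[OF cG ne this] obtain z0 where z0: "z0 \<in> path_image G"
    "\<And>z. z \<in> path_image G \<Longrightarrow> norm (z0 - 1) + norm (z0 + 1) \<le> norm (z - 1) + norm (z + 1)"
    by blast
  define m where "m = norm (z0 - 1) + norm (z0 + 1)"
  have "z0 \<notin> ?K"
  proof
    assume "z0 \<in> ?K"
    then obtain x where "x \<in> {-1..1}" "z0 = complex_of_real x" by blast
    with dist[OF z0(1), of x] e show False by simp
  qed
  then have m: "m > 2"
    unfolding m_def by (rule focal_sum_gt_2)
  \<comment> \<open>Chosen so that (R - 1)^2 = m - 2. Then R + 1/R - 2 = (R - 1)^2 / R is strictly
    smaller than m - 2.\<close>
  define R where "R = 1 + sqrt (m - 2)"
  have R: "R > 1" using m by (simp add: R_def)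
  have "R + 1 / R - 2 = (R - 1)\<^sup>2 / R"
    using R by (simp add: field_simps power2_eq_square)
  also have "\<dots> < (R - 1)\<^sup>2"
    using R by (simp add: field_simps)
  also have "\<dots> = m - 2"
    using m by (simp add: R_def)
  finally have Rm: "R + 1 / R < m" by simp
  \<comment> \<open>Half of 1 - 1/R: for n >= 1 one has R^n - 1 >= (1 - 1/R) R^n.\<close>
  define A where "A = (R - 1) / (2 * R)"
  have A: "A > 0" using R by (simp add: A_def)
  have cheb: "norm (poly (chebyshev n) z) \<ge> A * R ^ n" if "z \<in> path_image G" "n \<ge> 1" for z n
  proof -
    obtain u where u: "norm u \<ge> 1" "z = (u + 1 / u) / 2"
      by (rule joukowski_surj)
    have "u \<noteq> 0" using u by auto
    have "R + 1 / R < norm u + 1 / norm u"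
      using Rm z0(2)[OF that(1)] joukowski_focal_sum[OF \<open>u \<noteq> 0\<close>] u(2) unfolding m_def by simp
    then have "R < norm u"
      using plus_inverse_mono[of R "norm u"] R u by simp
    then have "norm (poly (chebyshev n) z) \<ge> (R ^ n - 1) / 2"
      unfolding u(2) using R by (intro norm_chebyshev_ge) auto
    moreover have "(R - 1) / R * R ^ n \<le> R ^ n - 1"
    proof -
      have "R ^ n / R \<ge> 1"
        using R that(2) by (simp add: self_le_power)
      then show ?thesis using R by (simp add: field_simps)
    qed
    moreover have "A * R ^ n = (R - 1) / R * R ^ n / 2"
      by (simp add: A_def)
    ultimately show ?thesis
      by simp
  qed
  have contf: "continuous_on (path_image G) f"
    using f GS holomorphic_on_imp_continuous_on continuous_on_subset by blast
  obtain B where B: "B > 0" "\<And>z. z \<in> path_image G \<Longrightarrow> norm (f z) \<le> B"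
    using compact_imp_bounded[OF compact_continuous_image[OF contf cG]]
    by (auto simp: bounded_pos)
  \<comment> \<open>The perimeter of the rectangle. \<open>C\<close> collects it, the bound on the
    remainder \<open>E\<close> below without its factor 1/R^n, and the Cauchy factor.\<close>
  define L where "L = 2 * (Re b - Re a + (Im b - Im a))"
  define C where "C = B / (A * e) * L / (2 * pi)"
  have L: "L > 0"
    using e by (simp add: L_def a_def b_def)
  have C: "C > 0"
    using L A B e by (simp add: C_def)
  have "\<exists>q :: real poly. degree q \<le> n - 1 \<and>
       (\<forall>x\<in>{-1..1}. \<bar>Re (f (complex_of_real x)) - poly q x\<bar> \<le> C / R ^ n)" if n: "n \<ge> 1" for n
  proof -
    define T where "T = chebyshev n"
    have T: "norm (poly T z) \<ge> A * R ^ n" "poly T z \<noteq> 0" if "z \<in> path_image G" for z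
    proof -
      show 1: "norm (poly T z) \<ge> A * R ^ n"
        unfolding T_def using cheb that n by blast
      have "A * R ^ n > 0" using A R by simp
      with 1 show "poly T z \<noteq> 0" by auto
    qed
    obtain c where c: "\<And>z x. poly T z - poly T x = (z - x) * (\<Sum>j<degree T. poly (c j) z * x ^ j)"
      using poly_divided_difference[of T] by blast
    \<comment> \<open>The part of the modified Cauchy kernel that multiplies x^j; its integral
      \<open>\<kappa> j\<close> is the j-th coefficient of a complex approximating
      polynomial.\<close>
    define h where "h j z = f z * poly (c j) z / poly T z" for j z
    define \<kappa> where "\<kappa> j = contour_integral G (h j) / (2 * pi * \<i>)" for j
    \<comment> \<open>Taking real parts of the coefficients gives the real part of the complex
      polynomial at real x, so the error for the real part of \<open>f\<close> does not
      grow.\<close>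
    define q where "q = (\<Sum>j<degree T. monom (Re (\<kappa> j)) j)"
    have h: "(h j has_contour_integral contour_integral G (h j)) G" for j
    proof -
      have "continuous_on (path_image G) (h j)"
        unfolding h_def using T by (intro continuous_intros contf) auto
      then have "h j contour_integrable_on G"
        unfolding G_def by (rule contour_integrable_continuous_rectpath)
      then show ?thesis
        by (rule has_contour_integral_integral)
    qed
    have "degree q \<le> n - 1"
      unfolding q_def
    proof (rule degree_sum_le)
      fix j assume "j \<in> {..<degree T}"
      then have "j \<le> n - 1"
        using degree_chebyshev_le[of n] by (auto simp: T_def)
      then show "degree (monom (Re (\<kappa> j)) j) \<le> n - 1"
        by (meson degree_monom_le order_trans)
    qed auto
    moreover have "\<bar>Re (f (complex_of_real x)) - poly q x\<bar> \<le> C / R ^ n" if x: "x \<in> {-1..1}" for x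
    proof -
      let ?x = "complex_of_real x"
      \<comment> \<open>What remains of the Cauchy integrand after the polynomial part is
        subtracted.\<close>
      define E where "E z = f z * poly T ?x / (poly T z * (z - ?x))" for z
      have zx: "z \<noteq> ?x" if "z \<in> path_image G" for z
        using dist[OF that x] e by auto
      have xbox: "?x \<in> box a b"
        using x e by (auto simp: a_def b_def in_box_complex_iff)
      have "?x \<in> interior S"
        using S x by (auto simp: interior_open)
      then have "((\<lambda>w. f w / (w - ?x)) has_contour_integral
          (2 * pi * \<i> * winding_number G ?x * f ?x)) G"
        using GS zx by (intro Cauchy_integral_formula_convex_simple[OF S(2) f]) (auto simp: G_def)
      moreover have "winding_number G ?x = 1"
        unfolding G_def by (rule winding_number_rectpath[OF xbox])
      ultimately have I: "((\<lambda>w. f w / (w - ?x)) has_contour_integral (2 * pi * \<i> * f ?x)) G"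
        by simp
      have "((\<lambda>z. \<Sum>j<degree T. h j z * ?x ^ j) has_contour_integral
          (\<Sum>j<degree T. contour_integral G (h j) * ?x ^ j)) G"
        by (intro has_contour_integral_sum has_contour_integral_rmul h) auto
      from has_contour_integral_diff[OF I this]
      have "(E has_contour_integral (2 * pi * \<i> * f ?x - (\<Sum>j<degree T. contour_integral G (h j) * ?x ^ j))) G"
      proof (rule has_contour_integral_eq)
        fix z assume z: "z \<in> path_image G"
        have "(\<Sum>j<degree T. h j z * ?x ^ j) = f z / poly T z * (\<Sum>j<degree T. poly (c j) z * ?x ^ j)"
          by (simp add: h_def sum_distrib_left mult_ac)
        also have "(\<Sum>j<degree T. poly (c j) z * ?x ^ j) = (poly T z - poly T ?x) / (z - ?x)"
          using zx[OF z] by (simp add: c)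
        also have "f z / (z - ?x) - f z / poly T z * ((poly T z - poly T ?x) / (z - ?x)) = E z"
        proof -
          have "F / d - F / s * ((s - t) / d) = F * t / (s * d)" if "s \<noteq> 0" "d \<noteq> 0" for F d s t :: complex
            using that by (simp add: field_simps)
          then show ?thesis
            using zx[OF z] T(2)[OF z] by (simp add: E_def)
        qed
        finally show "f z / (z - ?x) - (\<Sum>j<degree T. h j z * ?x ^ j) = E z" .
      qed
      then have E: "contour_integral G E = 2 * pi * \<i> * f ?x - (\<Sum>j<degree T. contour_integral G (h j) * ?x ^ j)"
        by (rule contour_integral_unique)
      have "continuous_on (path_image G) E"
        unfolding E_def using T zx by (intro continuous_intros contf) auto
      moreover have "norm (E z) \<le> B / (A * e) / R ^ n" if z: "z \<in> path_image G" for z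
      proof -
        have "norm (E z) \<le> B * 1 / (A * R ^ n * e)"
          unfolding E_def norm_divide norm_mult
          using T[OF z] dist[OF z x] B z A R e norm_chebyshev_of_real_le[OF x, of n]
          by (intro frac_le mult_mono) (auto simp: T_def)
        then show ?thesis by (simp add: mult_ac)
      qed
      ultimately have "norm (contour_integral G E) \<le> 2 * (B / (A * e) / R ^ n) * (Re b - Re a + (Im b - Im a))"
        unfolding G_def by (intro contour_integral_rectpath_bound le) auto
      then have "norm (contour_integral G E) / (2 * pi) \<le>
          2 * (B / (A * e) / R ^ n) * (Re b - Re a + (Im b - Im a)) / (2 * pi)"
        by (rule divide_right_mono) simp
      also have "\<dots> = C / R ^ n"
        unfolding C_def L_def
        by (simp only: times_divide_eq_left times_divide_eq_right divide_divide_eq_left mult_ac)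
      finally have "norm (contour_integral G E / (2 * pi * \<i>)) \<le> C / R ^ n"
        by (simp add: norm_divide norm_mult)
      moreover have "contour_integral G E / (2 * pi * \<i>) = f ?x - (\<Sum>j<degree T. \<kappa> j * ?x ^ j)"
        unfolding E by (simp add: diff_divide_distrib sum_divide_distrib \<kappa>_def)
      moreover have "Re (f ?x) - poly q x = Re (f ?x - (\<Sum>j<degree T. \<kappa> j * ?x ^ j))"
        by (simp add: q_def poly_sum poly_monom flip: of_real_power)
      ultimately show ?thesis
        using abs_Re_le_cmod order_trans by metis
    qed
    ultimately show ?thesis by blast
  qed
  with that C R show thesis by blast
qed

section \<open>Inequalities of Markov and Nikolskii type\<close>

lemma poly_as_sum_atMost:
  fixes p :: "'a::comm_semiring_1 poly"
  assumes "degree p \<le> n"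
  shows "poly p x = (\<Sum>k\<le>n. coeff p k * x ^ k)"
  unfolding poly_altdef using assms
  by (intro sum.mono_neutral_left) (auto simp: coeff_eq_0)

text \<open>Multiplying h((w + 1/w)/2) by w^n clears the pole at 0 and gives the entire function
  \<open>F\<close>. On the unit circle 1/w is the conjugate of w, so the argument of h is real in
  [-1,1] and \<open>F\<close> is bounded by \<open>M\<close>; the maximum principle extends this to
  the disc.\<close>

lemma bernstein_walsh:
  fixes h :: "complex poly"
  assumes deg: "degree h \<le> n"
    and M: "\<And>x. x \<in> {-1..1} \<Longrightarrow> norm (poly h (complex_of_real x)) \<le> M"
    and u: "norm u \<ge> 1"
  shows "norm (poly h ((u + 1 / u) / 2)) \<le> M * norm u ^ n"
proof -
  define F where "F w = (\<Sum>k\<le>n. coeff h k * (((w\<^sup>2 + 1) / 2) ^ k * w ^ (n - k)))" for w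
  have F: "F w = w ^ n * poly h ((w + 1 / w) / 2)" if "w \<noteq> 0" for w
    unfolding F_def poly_as_sum_atMost[OF deg] sum_distrib_left
  proof (rule sum.cong)
    fix k assume "k \<in> {..n}"
    then have "w ^ n = w ^ k * w ^ (n - k)"
      by (simp flip: power_add)
    moreover have "(w\<^sup>2 + 1) / 2 = w * ((w + 1 / w) / 2)"
      using that by (simp add: field_simps power2_eq_square)
    ultimately show "coeff h k * (((w\<^sup>2 + 1) / 2) ^ k * w ^ (n - k)) = w ^ n * (coeff h k * ((w + 1 / w) / 2) ^ k)"
      by (simp only: power_mult_distrib mult_ac)
  qed auto
  have circle: "norm (F w) \<le> M" if "norm w = 1" for w
  proof -
    have "w \<noteq> 0" using that by auto
    have "1 / w = cnj w"
      using that \<open>w \<noteq> 0\<close> by (simp add: field_simps complex_norm_square[symmetric])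
    then have "(w + 1 / w) / 2 = of_real (Re w)"
      by (simp add: complex_add_cnj)
    moreover have "Re w \<in> {-1..1}"
      using abs_Re_le_cmod[of w] that by (auto simp: abs_le_iff)
    ultimately show ?thesis
      using M that by (simp add: F[OF \<open>w \<noteq> 0\<close>] norm_mult norm_power)
  qed
  have hol: "F holomorphic_on S" for S
    unfolding F_def by (intro holomorphic_intros) auto
  \<comment> \<open>The Joukowski map is invariant under inversion, so \<open>F\<close> can be used
    at \<open>1 / u\<close>, which lies in the unit disc.\<close>
  have "norm (F (1 / u)) \<le> M"
  proof (rule maximum_modulus_frontier[OF hol holomorphic_on_imp_continuous_on[OF hol]])
    show "1 / u \<in> cball 0 1"
      using u by (simp add: norm_divide divide_le_eq_1)
  qed (simp_all add: circle)
  moreover have "u \<noteq> 0" using u by auto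
  moreover have "norm (F (1 / u)) = norm (poly h ((u + 1 / u) / 2)) / norm u ^ n"
  proof -
    have "F (1 / u) = (1 / u) ^ n * poly h ((1 / u + u) / 2)"
      using F[of "1 / u"] \<open>u \<noteq> 0\<close> by simp
    then show ?thesis
      by (simp only: norm_mult norm_power norm_divide power_one_over add.commute[of "1 / u" u]) simp
  qed
  ultimately show ?thesis
    by (simp add: field_simps)
qed

lemma poly_map_poly_of_real:
  "poly (map_poly of_real p) (of_real x :: complex) = of_real (poly p x)"
  by (induction p) (auto simp: map_poly_pCons)

lemma pderiv_map_poly_of_real:
  "pderiv (map_poly of_real p :: complex poly) = map_poly of_real (pderiv p)"
  by (rule poly_eqI) (simp add: coeff_pderiv coeff_map_poly)

text \<open>Markov's inequality with a worse constant; only polynomial growth in the degree matters.\<close>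
lemma weak_markov:
  fixes h :: "real poly"
  assumes deg: "degree h \<le> n" and n: "n \<ge> 1"
    and M: "\<And>x. x \<in> {-1..1} \<Longrightarrow> \<bar>poly h x\<bar> \<le> M"
    and x: "x \<in> {-1..1}"
  shows "\<bar>poly (pderiv h) x\<bar> \<le> exp 4 * real n ^ 2 * M"
proof -
  define H :: "complex poly" where "H = map_poly of_real h"
  have degH: "degree H \<le> n"
    unfolding H_def using deg by (simp add: degree_map_poly)
  have M0: "M \<ge> 0" using M[OF x] by linarith
  have MH: "norm (poly H (complex_of_real y)) \<le> M" if "y \<in> {-1..1}" for y
    using M[OF that] by (simp add: H_def poly_map_poly_of_real)
  \<comment> \<open>The radius for Cauchy's estimate. Points this close to [-1,1] have focal sum at
    most 2 + 2/n^2, hence a preimage of modulus below 1 + 4/n, whose n-th power stays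
    bounded.\<close>
  define d where "d = 1 / real n ^ 2"
  have d: "d > 0" using n by (simp add: d_def)
  have "norm (poly H z) \<le> exp 4 * M" if z: "norm (complex_of_real x - z) = d" for z
  proof -
    obtain u where u: "norm u \<ge> 1" "z = (u + 1 / u) / 2"
      by (rule joukowski_surj)
    have "u \<noteq> 0" using u by auto
    have "norm (z - 1) \<le> norm (z - of_real x) + norm (complex_of_real x - 1)"
      "norm (z + 1) \<le> norm (z - of_real x) + norm (complex_of_real x + 1)"
      using norm_triangle_ineq[of "z - of_real x" "complex_of_real x - 1"]
        norm_triangle_ineq[of "z - of_real x" "complex_of_real x + 1"] by simp_all
    moreover have "norm (complex_of_real x - 1) + norm (complex_of_real x + 1) = 2"
      using x by (simp add: cmod_def)
    ultimately have "norm (z - 1) + norm (z + 1) \<le> 2 + 2 * d"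
      using z by (simp add: norm_minus_commute)
    then have ud: "norm u + 1 / norm u \<le> 2 + 2 * d"
      using joukowski_focal_sum[OF \<open>u \<noteq> 0\<close>] u(2) by simp
    \<comment> \<open>Since (R - 1)^2 = 16d, the excess R + 1/R - 2 equals 16d/R, and R <= 5 makes
      it larger than 2d.\<close>
    define R where "R = 1 + 4 / real n"
    have R: "1 \<le> R" "R \<le> 5" using n by (simp_all add: R_def field_simps)
    have "2 * d < 16 * d / 5" using d by simp
    also have "16 * d / 5 \<le> 16 * d / R"
      using R d by (intro divide_left_mono) auto
    also have "16 * d / R = R + 1 / R - 2"
    proof -
      have "16 * d = (R - 1)\<^sup>2"
        by (simp add: R_def d_def power_divide)
      then show ?thesis using R by (simp add: field_simps power2_eq_square)
    qed
    finally have "2 + 2 * d < R + 1 / R" by simp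
    with ud have "norm u + 1 / norm u < R + 1 / R" by simp
    then have "norm u < R"
      using plus_inverse_mono u R by blast
    then have "norm u ^ n \<le> R ^ n"
      by (intro power_mono) auto
    also have "R ^ n \<le> exp (4 / real n) ^ n"
      unfolding R_def by (intro power_mono exp_ge_add_one_self) auto
    also have "\<dots> = exp 4"
      using n by (simp flip: exp_of_nat_mult)
    finally have "norm u ^ n \<le> exp 4" .
    moreover have "norm (poly H z) \<le> M * norm u ^ n"
      unfolding u(2) by (rule bernstein_walsh[OF degH MH u(1)])
    ultimately show ?thesis
      using M0 by (smt (verit) mult.commute mult_left_mono)
  qed
  then have "norm ((deriv ^^ 1) (poly H) (of_real x)) \<le> fact 1 * (exp 4 * M) / d ^ 1"
    using d by (intro Cauchy_inequality) (auto intro!: holomorphic_intros continuous_intros)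
  moreover have "deriv (poly H) (of_real x) = of_real (poly (pderiv h) x)"
    using DERIV_imp_deriv[OF poly_DERIV[of H]]
    by (simp add: H_def pderiv_map_poly_of_real poly_map_poly_of_real)
  ultimately show ?thesis
    by (simp add: d_def mult_ac)
qed

section \<open>Integrability and lower bounds for the Jacobi measure\<close>

lemma borel_measurable_jacobi_measure:
  fixes f :: "real \<Rightarrow> real"
  assumes "continuous_on {-1..1} f"
  shows "f \<in> borel_measurable (jacobi_measure \<beta>\<^sub>1 \<beta>\<^sub>2)"
proof -
  have "f \<in> borel_measurable (restrict_space borel {-1..1})"
    by (rule borel_measurable_continuous_on_restrict[OF assms])
  moreover have "sets (jacobi_measure \<beta>\<^sub>1 \<beta>\<^sub>2) = sets (restrict_space borel {-1..1})"
    by (simp add: jacobi_measure_def sets_restrict_space)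
  ultimately show ?thesis
    by (simp cong: measurable_cong_sets)
qed

lemma space_jacobi_measure [simp]: "space (jacobi_measure \<beta>\<^sub>1 \<beta>\<^sub>2) = {-1..1}"
  by (simp add: jacobi_measure_def space_restrict_space)

lemma integrable_jacobi_measure:
  fixes f :: "real \<Rightarrow> real"
  assumes "\<beta>\<^sub>1 > -1" "\<beta>\<^sub>2 > -1" "continuous_on {-1..1} f"
  shows "integrable (jacobi_measure \<beta>\<^sub>1 \<beta>\<^sub>2) f"
proof -
  interpret prob_space "jacobi_measure \<beta>\<^sub>1 \<beta>\<^sub>2"
    using assms by (intro prob_space_jacobi_measure)
  have "compact (f ` {-1..1})"
    using assms by (intro compact_continuous_image) auto
  then obtain B where "\<And>x. x \<in> {-1..1} \<Longrightarrow> norm (f x) \<le> B"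
    using compact_imp_bounded bounded_iff by (metis imageI)
  then show ?thesis
    using borel_measurable_jacobi_measure[OF assms(3)]
    by (intro integrable_const_bound[of _ B]) auto
qed

lemma emeasure_jacobi_measure:
  assumes "A \<in> sets borel" "A \<subseteq> {-1..1}"
  shows "emeasure (jacobi_measure \<beta>\<^sub>1 \<beta>\<^sub>2) A =
    (\<integral>\<^sup>+x\<in>A. ennreal (jacobi_const \<beta>\<^sub>1 \<beta>\<^sub>2 * jacobi_weight \<beta>\<^sub>1 \<beta>\<^sub>2 x) \<partial>lborel)"
proof -
  have "A \<in> sets (restrict_space lborel {-1..1})"
    using assms by (auto simp: sets_restrict_space_iff)
  then have "emeasure (jacobi_measure \<beta>\<^sub>1 \<beta>\<^sub>2) A =
     (\<integral>\<^sup>+x\<in>A. ennreal (jacobi_const \<beta>\<^sub>1 \<beta>\<^sub>2 * jacobi_weight \<beta>\<^sub>1 \<beta>\<^sub>2 x) \<partial>restrict_space lborel {-1..1})"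
    unfolding jacobi_measure_def
    by (subst emeasure_density) (auto intro!: measurable_restrict_space1)
  also have "\<dots> = (\<integral>\<^sup>+x\<in>A. ennreal (jacobi_const \<beta>\<^sub>1 \<beta>\<^sub>2 * jacobi_weight \<beta>\<^sub>1 \<beta>\<^sub>2 x) \<partial>lborel)"
    using assms by (subst nn_integral_restrict_space) (auto intro!: nn_integral_cong split: split_indicator)
  finally show ?thesis .
qed

text \<open>A nonpositive constant would make the \<open>ennreal\<close> density vanish, against
  total mass 1.\<close>

lemma jacobi_const_pos:
  assumes "\<beta>\<^sub>1 > -1" "\<beta>\<^sub>2 > -1"
  shows "jacobi_const \<beta>\<^sub>1 \<beta>\<^sub>2 > 0"
proof (rule ccontr)
  assume "\<not> ?thesis"
  then have "ennreal (jacobi_const \<beta>\<^sub>1 \<beta>\<^sub>2 * jacobi_weight \<beta>\<^sub>1 \<beta>\<^sub>2 x) = 0" for x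
    by (intro ennreal_neg mult_nonpos_nonneg) (auto simp: jacobi_weight_def)
  then have "emeasure (jacobi_measure \<beta>\<^sub>1 \<beta>\<^sub>2) {-1..1} = 0"
    by (subst emeasure_jacobi_measure) auto
  moreover have "emeasure (jacobi_measure \<beta>\<^sub>1 \<beta>\<^sub>2) {-1..1} = 1"
    using prob_space.emeasure_space_1[OF prob_space_jacobi_measure[OF assms]] by simp
  ultimately show False by simp
qed

text \<open>One bound for both signs of the exponent. For \<beta> >= 0 monotonicity suffices; for
  negative \<beta> the power is smallest at x = 2, where it exceeds 1/2.\<close>

lemma powr_ge_half_power:
  fixes \<beta> t x :: real
  assumes "\<beta> > -1" "0 < t" "t \<le> 1" "t \<le> x" "x \<le> 2"
  shows "x powr \<beta> \<ge> t ^ nat \<lceil>\<beta>\<rceil> / 2"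
proof (cases "\<beta> \<ge> 0")
  case True
  have "t ^ nat \<lceil>\<beta>\<rceil> = t powr real (nat \<lceil>\<beta>\<rceil>)"
    using assms by (subst powr_realpow) auto
  also have "\<dots> \<le> t powr \<beta>"
    using assms by (intro powr_mono') (auto simp: True)
  also have "\<dots> \<le> x powr \<beta>"
    using assms True by (intro powr_mono2) auto
  finally have "t ^ nat \<lceil>\<beta>\<rceil> \<le> x powr \<beta>" .
  moreover have "t ^ nat \<lceil>\<beta>\<rceil> \<ge> 0" using assms by simp
  ultimately show ?thesis by linarith
next
  case False
  have "t ^ nat \<lceil>\<beta>\<rceil> / 2 \<le> 2 powr (-1)"
    using assms by (simp add: powr_minus power_le_one)
  also have "\<dots> \<le> 2 powr \<beta>"
    using assms by (intro powr_mono) auto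
  also have "\<dots> \<le> x powr \<beta>"
    using assms False by (intro powr_mono2') auto
  finally show ?thesis .
qed

text \<open>On the middle third of the interval both 1 - x and 1 + x are at least s/3, so the weight
  is bounded below by a power of s even where it vanishes at an endpoint.\<close>

lemma jacobi_measure_interval_ge:
  assumes \<beta>: "\<beta>\<^sub>1 > -1" "\<beta>\<^sub>2 > -1"
  obtains c k where "c > 0"
    "\<And>y s. 0 < s \<Longrightarrow> {y..y + s} \<subseteq> {-1..1} \<Longrightarrow> measure (jacobi_measure \<beta>\<^sub>1 \<beta>\<^sub>2) {y..y + s} \<ge> c * s ^ k"
proof -
  interpret prob_space "jacobi_measure \<beta>\<^sub>1 \<beta>\<^sub>2"
    using \<beta> by (intro prob_space_jacobi_measure)
  let ?\<kappa> = "jacobi_const \<beta>\<^sub>1 \<beta>\<^sub>2"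
  define k where "k = nat \<lceil>\<beta>\<^sub>1\<rceil> + nat \<lceil>\<beta>\<^sub>2\<rceil>"
  \<comment> \<open>The 4 comes from the two halves in the bounds on the factors, the power of 3
    from t = s/3 in t^k times the length t of the middle third.\<close>
  define c where "c = ?\<kappa> / 4 / 3 ^ Suc k"
  have \<kappa>: "?\<kappa> > 0" by (rule jacobi_const_pos[OF \<beta>])
  have "c > 0" using \<kappa> by (simp add: c_def)
  moreover have "measure (jacobi_measure \<beta>\<^sub>1 \<beta>\<^sub>2) {y..y + s} \<ge> c * s ^ Suc k"
    if s: "0 < s" "{y..y + s} \<subseteq> {-1..1}" for y s
  proof -
    define t where "t = s / 3"
    have y: "y \<ge> -1" "y + s \<le> 1" using s by auto
    have t: "0 < t" "t \<le> 1" using s y by (auto simp: t_def)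
    have w: "jacobi_weight \<beta>\<^sub>1 \<beta>\<^sub>2 x \<ge> t ^ k / 4" if "x \<in> {y + t..y + 2 * t}" for x
    proof -
      have "t \<le> 1 - x" "1 - x \<le> 2" "t \<le> 1 + x" "1 + x \<le> 2"
        using that y t s by (auto simp: t_def)
      then have "(t ^ nat \<lceil>\<beta>\<^sub>1\<rceil> / 2) * (t ^ nat \<lceil>\<beta>\<^sub>2\<rceil> / 2) \<le> jacobi_weight \<beta>\<^sub>1 \<beta>\<^sub>2 x"
        unfolding jacobi_weight_def using t \<beta>
        by (intro mult_mono powr_ge_half_power) auto
      then show ?thesis by (simp add: k_def power_add)
    qed
    have "ennreal (c * s ^ Suc k) = ennreal (?\<kappa> * (t ^ k / 4)) * ennreal t"
      using \<kappa> t by (simp add: c_def t_def power_divide field_simps flip: ennreal_mult)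
    also have "\<dots> = (\<integral>\<^sup>+x\<in>{y + t..y + 2 * t}. ennreal (?\<kappa> * (t ^ k / 4)) \<partial>lborel)"
      using t by (simp add: nn_integral_cmult_indicator)
    also have "\<dots> \<le> (\<integral>\<^sup>+x\<in>{y..y + s}. ennreal (?\<kappa> * jacobi_weight \<beta>\<^sub>1 \<beta>\<^sub>2 x) \<partial>lborel)"
      using w \<kappa> t by (intro nn_integral_mono)
        (auto split: split_indicator simp: t_def intro!: ennreal_leI mult_left_mono)
    also have "\<dots> = emeasure (jacobi_measure \<beta>\<^sub>1 \<beta>\<^sub>2) {y..y + s}"
      using s by (intro emeasure_jacobi_measure[symmetric]) auto
    also have "\<dots> = ennreal (measure (jacobi_measure \<beta>\<^sub>1 \<beta>\<^sub>2) {y..y + s})"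
      by (rule emeasure_eq_measure)
    finally show ?thesis by simp
  qed
  ultimately show thesis using that by blast
qed

text \<open>Near a point where |h| attains its maximum M, Markov's inequality keeps |h| above M/2 on
  an interval whose length is of order 1/n^2. The mass of this interval bounds the mean square from
  below.\<close>

lemma nikolskii_jacobi:
  assumes \<beta>: "\<beta>\<^sub>1 > -1" "\<beta>\<^sub>2 > -1"
  obtains C k where "C > 0"
    "\<And>n (h :: real poly) x. n \<ge> 1 \<Longrightarrow> degree h \<le> n \<Longrightarrow> x \<in> {-1..1} \<Longrightarrow>
       (poly h x)\<^sup>2 \<le> C * real n ^ k * (LINT t|jacobi_measure \<beta>\<^sub>1 \<beta>\<^sub>2. (poly h t)\<^sup>2)"
proof -
  let ?\<rho> = "jacobi_measure \<beta>\<^sub>1 \<beta>\<^sub>2"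
  interpret prob_space ?\<rho>
    using \<beta> by (intro prob_space_jacobi_measure)
  obtain c k where c: "c > 0" and meas:
    "\<And>y s. 0 < s \<Longrightarrow> {y..y + s} \<subseteq> {-1..1} \<Longrightarrow> measure ?\<rho> {y..y + s} \<ge> c * s ^ k"
    by (rule jacobi_measure_interval_ge[OF \<beta>]) blast
  \<comment> \<open>This is 4/(c s^k) for the \<open>s\<close> below, with n^(2k) split off; the 4
    undoes the square of M/2.\<close>
  define C where "C = 4 * (2 * exp 4) ^ k / c"
  have "C > 0" using c by (simp add: C_def)
  moreover have "(poly h x)\<^sup>2 \<le> C * real n ^ (2 * k) * (LINT t|?\<rho>. (poly h t)\<^sup>2)"
    if n: "n \<ge> 1" "degree h \<le> n" and x: "x \<in> {-1..1}" for n x and h :: "real poly"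
  proof -
    have "continuous_on {-1..1::real} (\<lambda>x. \<bar>poly h x\<bar>)"
      by (intro continuous_intros)
    then obtain x0 where x0: "x0 \<in> {-1..1}" "\<And>x. x \<in> {-1..1} \<Longrightarrow> \<bar>poly h x\<bar> \<le> \<bar>poly h x0\<bar>"
      using continuous_attains_sup[of "{-1..1::real}"] x by (metis compact_Icc empty_iff)
    define M where "M = \<bar>poly h x0\<bar>"
    define D where "D = exp 4 * real n ^ 2"
    define s where "s = 1 / (2 * D)"
    have D: "D \<ge> 1"
      unfolding D_def using n mult_mono[of 1 "exp 4" 1 "real n ^ 2"] by simp
    have s: "0 < s" "s \<le> 1" using D by (auto simp: s_def)
    \<comment> \<open>The interval has \<open>x0\<close> as an endpoint and extends towards 0, so it
      stays inside [-1,1].\<close>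
    define y where "y = (if x0 \<le> 0 then x0 else x0 - s)"
    have sub: "{y..y + s} \<subseteq> {-1..1}"
      using x0(1) s by (auto simp: y_def split: if_splits)
    have half: "\<bar>poly h t\<bar> \<ge> M / 2" if t: "t \<in> {y..y + s}" for t
    proof -
      have t1: "t \<in> {-1..1}" using t sub by blast
      have "norm (poly h t - poly h x0) \<le> D * M * norm (t - x0)"
      proof (rule field_differentiable_bound[of "{-1..1}" _ "poly (pderiv h)"])
        show "norm (poly (pderiv h) z) \<le> D * M" if "z \<in> {-1..1}" for z
          unfolding D_def using weak_markov[of h n M z] n x0(2) that by (simp add: M_def)
      qed (use t1 x0 in \<open>auto intro: poly_DERIV DERIV_subset\<close>)
      also have "\<dots> \<le> D * M * s"
        using t s D by (intro mult_left_mono) (auto simp: y_def M_def split: if_splits)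
      also have "\<dots> = M / 2"
        using D by (simp add: s_def)
      finally have "\<bar>poly h t - poly h x0\<bar> \<le> M / 2"
        by simp
      then show ?thesis
        unfolding M_def by arith
    qed
    have int: "integrable ?\<rho> (\<lambda>t. (poly h t)\<^sup>2)"
      by (intro integrable_jacobi_measure \<beta> continuous_intros)
    have set: "{y..y + s} \<in> sets ?\<rho>"
      using sub by (simp add: jacobi_measure_def sets_restrict_space_iff)
    have "(M / 2)\<^sup>2 * (c * s ^ k) \<le> (M / 2)\<^sup>2 * measure ?\<rho> {y..y + s}"
      by (intro mult_left_mono meas s sub) auto
    also have "\<dots> = (LINT t|?\<rho>. (M / 2)\<^sup>2 * indicator {y..y + s} t)"
      by (simp only: integral_mult_right_zero Bochner_Integration.integral_indicator space_jacobi_measure Int_absorb2[OF sub])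
    also have "\<dots> \<le> (LINT t|?\<rho>. (poly h t)\<^sup>2)"
    proof (rule integral_mono)
      show "(M / 2)\<^sup>2 * indicator {y..y + s} t \<le> (poly h t)\<^sup>2" for t
      proof -
        have "(M / 2)\<^sup>2 \<le> \<bar>poly h t\<bar>\<^sup>2" if "t \<in> {y..y + s}"
          using that by (intro power_mono half) (auto simp: M_def)
        then show ?thesis by (auto split: split_indicator)
      qed
    next
      show "integrable ?\<rho> (\<lambda>t. (M / 2)\<^sup>2 * indicator {y..y + s} t)"
        using set by (intro integrable_mult_right) (auto intro!: integrable_real_indicator simp: emeasure_eq_measure)
    qed (rule int)
    finally have "4 / (c * s ^ k) * ((M / 2)\<^sup>2 * (c * s ^ k)) \<le> 4 / (c * s ^ k) * (LINT t|?\<rho>. (poly h t)\<^sup>2)"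
      using c s by (intro mult_left_mono) auto
    also have "4 / (c * s ^ k) * ((M / 2)\<^sup>2 * (c * s ^ k)) = M\<^sup>2"
      using c s by (simp add: power_divide)
    also have "4 / (c * s ^ k) = C * real n ^ (2 * k)"
      using c D by (simp add: C_def s_def D_def power_divide power_mult_distrib power_mult)
    finally have "M\<^sup>2 \<le> C * real n ^ (2 * k) * (LINT t|?\<rho>. (poly h t)\<^sup>2)" .
    moreover have "(poly h x)\<^sup>2 \<le> M\<^sup>2"
      using x0(2)[OF x] by (simp add: M_def abs_le_square_iff)
    ultimately show ?thesis by linarith
  qed
  ultimately show thesis using that by blast
qed

section \<open>Gauss quadrature\<close>

lemma prod_linear_factors_dvd:
  fixes p :: "'a::idom poly"
  assumes "finite S" "\<And>a. a \<in> S \<Longrightarrow> poly p a = 0"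
  shows "(\<Prod>a\<in>S. [:- a, 1:]) dvd p"
  using assms
proof (induction S)
  case (insert a S)
  then obtain s where s: "p = (\<Prod>b\<in>S. [:- b, 1:]) * s"
    by (auto elim: dvdE)
  have "poly (\<Prod>b\<in>S. [:- b, 1:]) a \<noteq> 0"
    using insert by (auto simp: poly_prod)
  with insert.prems[of a] s have "poly s a = 0" by auto
  then have "[:- a, 1:] dvd s"
    by (simp add: poly_eq_0_iff_dvd)
  then show ?case
    unfolding prod.insert[OF insert.hyps] s mult.commute[of _ s] by (rule mult_dvd_mono) simp
qed simp

lemma degree_prod_linear_factors:
  "degree (\<Prod>a\<in>S. [:- a, 1:] :: 'a::idom poly) = card S"
  by (subst degree_prod_eq_sum_degree) auto

lemma poly_pos_or_neg:
  fixes s :: "real poly"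
  assumes "\<And>x. poly s x \<noteq> 0"
  shows "(\<forall>x. poly s x > 0) \<or> (\<forall>x. poly s x < 0)"
proof (rule ccontr)
  assume "\<not> ?thesis"
  then obtain x y where "\<not> poly s x > 0" "\<not> poly s y < 0"
    by blast
  then have xy: "poly s x < 0" "poly s y > 0"
    using assms[of x] assms[of y] by linarith+
  then consider "x < y" | "y < x"
    by fastforce
  then show False
    using poly_IVT_pos[of x y s] poly_IVT_neg[of y x s] xy assms by cases blast+
qed

locale jacobi_polys =
  fixes \<beta>\<^sub>1 \<beta>\<^sub>2 :: real and P :: "nat \<Rightarrow> real poly"
  assumes \<beta>: "\<beta>\<^sub>1 > -1" "\<beta>\<^sub>2 > -1"
    and orthonormal: "orthonormal_polys (jacobi_measure \<beta>\<^sub>1 \<beta>\<^sub>2) P"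
begin

abbreviation \<rho> :: "real measure" where "\<rho> \<equiv> jacobi_measure \<beta>\<^sub>1 \<beta>\<^sub>2"

text \<open>Integration as a linear functional on polynomials, so that orthogonality arguments
  become polynomial algebra.\<close>

definition I :: "real poly \<Rightarrow> real" where "I p = (LINT x|\<rho>. poly p x)"

sublocale prob_space \<rho>
  by (rule prob_space_jacobi_measure[OF \<beta>])

lemma integrable_poly: "integrable \<rho> (poly p)"
  by (intro integrable_jacobi_measure \<beta> continuous_intros)

lemma I_add: "I (p + q) = I p + I q"
  using integrable_poly by (simp add: I_def)

lemma I_diff: "I (p - q) = I p - I q"
  using integrable_poly by (simp add: I_def)

lemma I_smult: "I (smult c p) = c * I p"
  by (simp add: I_def)

lemma I_minus: "I (- p) = - I p"
  by (simp add: I_def)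

lemma I_0: "I 0 = 0"
  by (simp add: I_def)

lemma I_1: "I 1 = 1"
  using prob_space by (simp add: I_def)

lemma I_sum: "I (\<Sum>a\<in>A. p a) = (\<Sum>a\<in>A. I (p a))"
  by (induction A rule: infinite_finite_induct) (auto simp: I_add I_0)

lemma degree_P: "degree (P n) = n"
  using orthonormal by (simp add: orthonormal_polys_def)

lemma I_P_mult_P: "I (P n * P m) = (if n = m then 1 else 0)"
  using orthonormal by (simp add: orthonormal_polys_def I_def)

lemma P_nonzero: "P n \<noteq> 0"
  using I_P_mult_P[of n n] by (auto simp: I_0)

text \<open>Subtracting a multiple of \<open>P d\<close>, with d the degree of \<open>q\<close>,
  cancels the leading term; induction on the degree handles the rest.\<close>

lemma I_P_mult_lower_degree:
  assumes "degree q < N"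
  shows "I (P N * q) = 0"
  using assms
proof (induction "degree q" arbitrary: q rule: less_induct)
  case less
  define d where "d = degree q"
  define c where "c = lead_coeff q / lead_coeff (P d)"
  define r where "r = q - smult c (P d)"
  have "degree r \<le> d"
    unfolding r_def by (intro degree_diff_le) (auto simp: d_def degree_P intro: order_trans[OF degree_smult_le])
  moreover have "coeff (P d) d \<noteq> 0"
    using P_nonzero[of d] leading_coeff_0_iff[of "P d"] by (simp add: degree_P)
  then have "coeff r d = 0"
    by (simp add: r_def c_def degree_P d_def[symmetric])
  ultimately have "r = 0 \<or> degree r < d"
    by (rule eq_zero_or_degree_less)
  then have "I (P N * r) = 0"
    using less by (auto simp: I_0 d_def)
  moreover have "P N * q = P N * r + smult c (P N * P d)"
    by (simp add: r_def algebra_simps)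
  ultimately show ?case
    using less.prems by (simp add: I_add I_smult I_P_mult_P d_def)
qed

lemma AE_jacobi_notin_finite:
  assumes "finite Z"
  shows "AE x in \<rho>. x \<notin> Z"
proof -
  have Z: "Z \<inter> {-1..1} \<in> sets borel"
    using assms by (simp add: finite_imp_closed borel_closed)
  have "AE x in lborel. x \<notin> Z"
    using assms by (intro AE_not_in finite_imp_null_set_lborel)
  then have AE: "AE x in lborel. ennreal (jacobi_const \<beta>\<^sub>1 \<beta>\<^sub>2 * jacobi_weight \<beta>\<^sub>1 \<beta>\<^sub>2 x) *
      indicator (Z \<inter> {-1..1}) x = 0"
    by eventually_elim (auto split: split_indicator)
  have "emeasure \<rho> (Z \<inter> {-1..1}) =
      (\<integral>\<^sup>+x\<in>Z \<inter> {-1..1}. ennreal (jacobi_const \<beta>\<^sub>1 \<beta>\<^sub>2 * jacobi_weight \<beta>\<^sub>1 \<beta>\<^sub>2 x) \<partial>lborel)"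
    by (rule emeasure_jacobi_measure[OF Z]) simp
  also have "\<dots> = (\<integral>\<^sup>+x. 0 \<partial>(lborel :: real measure))"
    by (rule nn_integral_cong_AE[OF AE])
  finally have "emeasure \<rho> (Z \<inter> {-1..1}) = 0"
    by simp
  then show ?thesis
    using Z by (intro AE_I[of _ _ "Z \<inter> {-1..1}"])
      (auto simp: jacobi_measure_def sets_restrict_space_iff space_restrict_space)
qed

text \<open>A nonnegative function with integral 0 vanishes almost everywhere, but the roots of a
  nonzero polynomial form a null set.\<close>

lemma I_pos:
  assumes "p \<noteq> 0" "\<And>x. x \<in> {-1..1} \<Longrightarrow> poly p x \<ge> 0"
  shows "I p > 0"
proof (rule ccontr)
  assume "\<not> ?thesis"
  moreover have "I p \<ge> 0"
    unfolding I_def using assms by (intro integral_nonneg_AE) auto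
  ultimately have "(LINT x|\<rho>. poly p x) = 0"
    by (simp add: I_def)
  then have "AE x in \<rho>. poly p x = 0"
    using assms by (subst (asm) integral_nonneg_eq_0_iff_AE[OF integrable_poly]) auto
  moreover have "AE x in \<rho>. x \<notin> {x. poly p x = 0}"
    using assms by (intro AE_jacobi_notin_finite poly_roots_finite)
  ultimately have "AE x in \<rho>. False"
    by eventually_elim auto
  then show False by simp
qed

lemma I_mult_square_neq_0:
  assumes "s \<noteq> 0" "q \<noteq> 0" "(\<forall>x\<in>{-1..1}. poly s x \<ge> 0) \<or> (\<forall>x\<in>{-1..1}. poly s x \<le> 0)"
  shows "I (s * q\<^sup>2) \<noteq> 0"
  using assms(3)
proof
  assume "\<forall>x\<in>{-1..1}. poly s x \<ge> 0"
  then have "I (s * q\<^sup>2) > 0"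
    using assms by (intro I_pos) auto
  then show ?thesis by simp
next
  assume "\<forall>x\<in>{-1..1}. poly s x \<le> 0"
  then have "I (- s * q\<^sup>2) > 0"
    using assms by (intro I_pos) (auto simp: mult_nonpos_nonneg)
  then show ?thesis by (simp add: I_minus)
qed

text \<open>The cofactor \<open>q\<close> has degree below N, so \<open>P N\<close> is orthogonal to
  it; yet \<open>P N * q\<close> is \<open>s\<close> times a square and cannot integrate to 0 if
  \<open>s\<close> keeps its sign. This excludes roots outside [-1,1], multiple roots and
  nonconstant factors without real roots.\<close>

lemma P_factor_sign:
  assumes "P N = s * q" "degree s > 0"
  shows "\<not> ((\<forall>x\<in>{-1..1}. poly s x \<ge> 0) \<or> (\<forall>x\<in>{-1..1}. poly s x \<le> 0))"
proof
  assume sign: "(\<forall>x\<in>{-1..1}. poly s x \<ge> 0) \<or> (\<forall>x\<in>{-1..1}. poly s x \<le> 0)"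
  have nz: "s \<noteq> 0" "q \<noteq> 0"
    using P_nonzero[of N] assms by auto
  have "degree q < N"
    using assms nz degree_P[of N] by (simp add: degree_mult_eq)
  then have "I (P N * q) = 0"
    by (rule I_P_mult_lower_degree)
  moreover have "P N * q = s * q\<^sup>2"
    by (simp add: assms power2_eq_square mult_ac)
  ultimately show False
    using I_mult_square_neq_0[OF nz sign] by simp
qed

lemma finite_quadrature_points: "finite (quadrature_points P N)"
  unfolding quadrature_points_def by (rule poly_roots_finite[OF P_nonzero])

lemma quadrature_points_subset: "quadrature_points P N \<subseteq> {-1..1}"
proof (rule ccontr)
  assume "\<not> ?thesis"
  then obtain a where "poly (P N) a = 0" "a \<notin> {-1..1}"
    unfolding quadrature_points_def by blast
  then have a: "poly (P N) a = 0" "a < -1 \<or> a > 1"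
    by auto
  then obtain q where "P N = [:- a, 1:] * q"
    by (auto simp: poly_eq_0_iff_dvd elim: dvdE)
  then show False
    using P_factor_sign[of N "[:- a, 1:]" q] a(2) by auto
qed

text \<open>A real root of the cofactor \<open>s\<close> would be a double root of
  \<open>P N\<close>, giving a nonnegative factor of degree 2. So \<open>s\<close> has no real root,
  keeps its sign and must be constant.\<close>

lemma P_eq_prod_linear_factors:
  "\<exists>c. c \<noteq> 0 \<and> P N = smult c (\<Prod>a\<in>quadrature_points P N. [:- a, 1:])"
proof -
  let ?S = "quadrature_points P N"
  define r where "r = (\<Prod>a\<in>?S. [:- a, 1:])"
  have "r dvd P N"
    unfolding r_def by (intro prod_linear_factors_dvd finite_quadrature_points) (simp add: quadrature_points_def)
  then obtain s where s: "P N = s * r"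
    by (metis dvdE mult.commute)
  have "poly s a \<noteq> 0" for a
  proof
    assume sa: "poly s a = 0"
    then have "a \<in> ?S" by (simp add: s quadrature_points_def)
    then have "poly r a = 0"
      using finite_quadrature_points by (simp add: r_def poly_prod)
    with sa obtain s' r' where "s = [:- a, 1:] * s'" "r = [:- a, 1:] * r'"
      by (auto simp: poly_eq_0_iff_dvd elim!: dvdE)
    then have "P N = [:- a, 1:]\<^sup>2 * (s' * r')"
      by (simp only: s power2_eq_square mult_ac)
    then show False
      using P_factor_sign[of N "[:- a, 1:]\<^sup>2" "s' * r'"] by (simp add: degree_power_eq)
  qed
  then have "(\<forall>x\<in>{-1..1}. poly s x \<ge> 0) \<or> (\<forall>x\<in>{-1..1}. poly s x \<le> 0)"
    using poly_pos_or_neg[of s] by (auto intro: less_imp_le)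
  then have "degree s = 0"
    using P_factor_sign[OF s] by blast
  then obtain c where "s = [:c:]" by (rule degree_eq_zeroE)
  with s P_nonzero[of N] show ?thesis
    by (auto simp: r_def)
qed

lemma card_quadrature_points: "card (quadrature_points P N) = N"
  using P_eq_prod_linear_factors[of N] degree_P[of N] by (auto simp: degree_prod_linear_factors)

text \<open>Exactness of Gauss quadrature below degree 2N: such a \<open>p\<close> is a multiple of
  \<open>P N\<close> with cofactor of degree below N.\<close>

lemma I_eq_0_if_vanishes_at_quadrature_points:
  assumes "degree p < 2 * N" "\<And>a. a \<in> quadrature_points P N \<Longrightarrow> poly p a = 0"
  shows "I p = 0"
proof (cases "p = 0")
  case False
  define r where "r = (\<Prod>a\<in>quadrature_points P N. [:- a, 1:])"
  have "r dvd p"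
    unfolding r_def using assms by (intro prod_linear_factors_dvd finite_quadrature_points)
  then obtain t where t: "p = r * t" by (auto elim: dvdE)
  obtain c where c: "c \<noteq> 0" "P N = smult c r"
    using P_eq_prod_linear_factors[of N] by (auto simp: r_def)
  have "degree r = N"
    by (simp add: r_def degree_prod_linear_factors card_quadrature_points)
  then have "degree t < N"
    using assms(1) False t by (auto simp: degree_mult_eq)
  then have "I (P N * t) = 0"
    by (rule I_P_mult_lower_degree)
  then show ?thesis
    using c t by (simp add: I_smult)
qed (simp add: I_0)

lemma lagrange_basis:
  assumes "a \<in> quadrature_points P N"
  obtains l where "degree l \<le> N - 1" "poly l a = 1"
    "\<And>b. b \<in> quadrature_points P N \<Longrightarrow> b \<noteq> a \<Longrightarrow> poly l b = 0"
proof -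
  let ?S = "quadrature_points P N"
  define r where "r = (\<Prod>b\<in>?S - {a}. [:- b, 1:])"
  have "degree r = N - 1"
    using assms finite_quadrature_points
    by (simp add: r_def degree_prod_linear_factors card_quadrature_points)
  moreover have "poly r a \<noteq> 0"
    using finite_quadrature_points by (auto simp: r_def poly_prod)
  moreover have "poly r b = 0" if "b \<in> ?S" "b \<noteq> a" for b
    using finite_quadrature_points that by (auto simp: r_def poly_prod)
  ultimately show thesis
    by (intro that[of "smult (1 / poly r a) r"]) auto
qed

text \<open>Exactness expresses the integral of a square through the node values with weights
  \<open>I ((l a)\<^sup>2)\<close>, the Christoffel numbers; they are nonnegative and sum to
  1.\<close>

lemma I_square_le:
  assumes N: "N \<ge> 1" and deg: "degree q \<le> N - 1"
    and le: "\<And>a. a \<in> quadrature_points P N \<Longrightarrow> \<bar>poly q a\<bar> \<le> e"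
  shows "I (q\<^sup>2) \<le> e\<^sup>2"
proof -
  let ?S = "quadrature_points P N"
  have "\<forall>a\<in>?S. \<exists>l. degree l \<le> N - 1 \<and> poly l a = 1 \<and> (\<forall>b\<in>?S. b \<noteq> a \<longrightarrow> poly l b = 0)"
    using lagrange_basis by metis
  then obtain l where l: "\<And>a. a \<in> ?S \<Longrightarrow> degree (l a) \<le> N - 1" "\<And>a. a \<in> ?S \<Longrightarrow> poly (l a) a = 1"
    "\<And>a b. a \<in> ?S \<Longrightarrow> b \<in> ?S \<Longrightarrow> b \<noteq> a \<Longrightarrow> poly (l a) b = 0"
    by metis
  have square: "degree (p\<^sup>2) < 2 * N" if "degree p \<le> N - 1" for p :: "real poly"
    using degree_power_le[of p 2] that N by simp
  have quad: "I (p\<^sup>2) = (\<Sum>a\<in>?S. (poly p a)\<^sup>2 * I ((l a)\<^sup>2))" if p: "degree p \<le> N - 1" for p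
  proof -
    \<comment> \<open>Interpolates p^2 at the nodes. Squares of the Lagrange polynomials are used so
      that the weights are visibly nonnegative.\<close>
    define w where "w = (\<Sum>a\<in>?S. smult ((poly p a)\<^sup>2) ((l a)\<^sup>2))"
    have "degree w < 2 * N"
      unfolding w_def using N l(1) square
      by (intro degree_sum_less) (auto intro: le_less_trans[OF degree_smult_le])
    moreover have "poly w b = (poly p b)\<^sup>2" if "b \<in> ?S" for b
    proof -
      have "poly w b = (\<Sum>a\<in>?S. if a = b then (poly p b)\<^sup>2 else 0)"
        unfolding w_def poly_sum using l that by (intro sum.cong) auto
      then show ?thesis
        using that finite_quadrature_points by simp
    qed
    ultimately have "I (p\<^sup>2 - w) = 0"
      using square[OF p] by (intro I_eq_0_if_vanishes_at_quadrature_points[of _ N] degree_diff_less) auto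
    then show ?thesis
      by (simp add: I_diff I_sum I_smult w_def)
  qed
  have nonneg: "I ((l a)\<^sup>2) \<ge> 0" for a
    unfolding I_def by (intro integral_nonneg_AE) auto
  have "I (q\<^sup>2) = (\<Sum>a\<in>?S. (poly q a)\<^sup>2 * I ((l a)\<^sup>2))"
    by (rule quad[OF deg])
  also have "\<dots> \<le> (\<Sum>a\<in>?S. e\<^sup>2 * I ((l a)\<^sup>2))"
    using le nonneg by (intro sum_mono mult_right_mono) (auto simp: abs_le_square_iff[symmetric] intro: order_trans[OF _ abs_ge_self])
  \<comment> \<open>The quadrature formula read backwards for the constant polynomial 1 sums the
    weights.\<close>
  also have "\<dots> = e\<^sup>2 * I (1\<^sup>2)"
    by (subst quad) (auto simp: sum_distrib_left)
  finally show ?thesis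
    by (simp add: I_1)
qed

end

section \<open>Transport distances between images of a measure\<close>

text \<open>The joint law of \<open>F\<close> and \<open>G\<close> is a coupling carried by the
  strip of points within \<open>d\<close> of the diagonal.\<close>

lemma (in prob_space) wasserstein_distr_le:
  assumes [measurable]: "F \<in> borel_measurable M" "G \<in> borel_measurable M"
    and d: "\<And>x. x \<in> space M \<Longrightarrow> \<bar>F x - G x\<bar> \<le> d" and p: "p \<ge> 1" and "d \<ge> 0"
  shows "wasserstein p (distr M borel F) (distr M borel G) \<le> ennreal d"
proof -
  define \<pi> where "\<pi> = distr M (borel \<Otimes>\<^sub>M borel) (\<lambda>x. (F x, G x))"
  have "sets \<pi> = sets borel"
    by (simp add: \<pi>_def borel_prod)
  moreover have "distr \<pi> borel fst = distr M borel F" "distr \<pi> borel snd = distr M borel G"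
    by (simp_all add: \<pi>_def distr_distr comp_def)
  ultimately have "\<pi> \<in> couplings (distr M borel F) (distr M borel G)"
    by (simp add: couplings_def)
  then have "transport_cost p (distr M borel F) (distr M borel G) \<le>
      (\<integral>\<^sup>+ z. ennreal (\<bar>fst z - snd z\<bar> powr p) \<partial>\<pi>)"
    unfolding transport_cost_def by (rule INF_lower)
  also have "\<dots> = (\<integral>\<^sup>+ x. ennreal (\<bar>F x - G x\<bar> powr p) \<partial>M)"
    unfolding \<pi>_def by (subst nn_integral_distr) auto
  also have "\<dots> \<le> (\<integral>\<^sup>+ x. ennreal (d powr p) \<partial>M)"
    using d p by (intro nn_integral_mono ennreal_leI powr_mono2) auto
  also have "\<dots> = ennreal (d powr p)"
    by (simp add: emeasure_space_1)
  finally have cost: "transport_cost p (distr M borel F) (distr M borel G) \<le> ennreal (d powr p)" .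
  then have "enn2real (transport_cost p (distr M borel F) (distr M borel G)) \<le> d powr p"
    by (intro enn2real_leI) auto
  then have "enn2real (transport_cost p (distr M borel F) (distr M borel G)) powr (1 / p) \<le> (d powr p) powr (1 / p)"
    using p by (intro powr_mono2) auto
  also have "\<dots> = d"
    using p \<open>d \<ge> 0\<close> by (simp add: powr_powr)
  \<comment> \<open>\<open>cost\<close> also excludes the infinite branch of
    \<open>wasserstein\<close>.\<close>
  finally show ?thesis
    using cost by (auto simp: wasserstein_def intro: ennreal_leI simp: top_unique)
qed

text \<open>At level y the tails differ by at most the mass of the points x for which y separates
  \<open>F x\<close> from \<open>G x\<close>. Integrating over y first gives the distance of the two
  values.\<close>

lemma (in prob_space) L1_norm_upper_cdf_distr_le:
  assumes [measurable]: "F \<in> borel_measurable M" "G \<in> borel_measurable M"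
    and d: "\<And>x. x \<in> space M \<Longrightarrow> \<bar>F x - G x\<bar> \<le> d"
  shows "L1_norm (\<lambda>y. upper_cdf (distr M borel F) y - upper_cdf (distr M borel G) y) \<le> ennreal d"
proof -
  interpret pair_sigma_finite M lborel ..
  \<comment> \<open>Open on the left and closed on the right, matching the closed tails: exactly one
    of \<open>y \<le> F x\<close> and \<open>y \<le> G x\<close> holds there.\<close>
  define D where "D x y = (indicator {min (F x) (G x)<..max (F x) (G x)} y :: ennreal)" for x y
  have D: "D x y = (if min (F x) (G x) < y \<and> y \<le> max (F x) (G x) then 1 else 0)" for x y
    by (simp add: D_def)
  have [measurable]: "(\<lambda>(x, y). D x y) \<in> borel_measurable (M \<Otimes>\<^sub>M lborel)"
    unfolding D by measurable
  have "ennreal \<bar>upper_cdf (distr M borel F) y - upper_cdf (distr M borel G) y\<bar> \<le> (\<integral>\<^sup>+ x. D x y \<partial>M)" for y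
  proof -
    define A where "A = {x \<in> space M. y \<le> F x}"
    define B where "B = {x \<in> space M. y \<le> G x}"
    have [measurable]: "A \<in> sets M" "B \<in> sets M"
      by (auto simp: A_def B_def)
    have cdf: "upper_cdf (distr M borel F) y = measure M A" "upper_cdf (distr M borel G) y = measure M B"
      by (auto simp: upper_cdf_def measure_distr A_def B_def intro!: arg_cong[of _ _ "measure M"])
    have "measure M A \<le> measure M B + measure M ((A - B) \<union> (B - A))"
      "measure M B \<le> measure M A + measure M ((A - B) \<union> (B - A))"
      by (rule order_trans[OF finite_measure_mono measure_Un_le]; auto)+
    then have "\<bar>measure M A - measure M B\<bar> \<le> measure M ((A - B) \<union> (B - A))"
      by linarith
    then have "ennreal \<bar>measure M A - measure M B\<bar> \<le> emeasure M ((A - B) \<union> (B - A))"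
      by (simp add: emeasure_eq_measure)
    also have "\<dots> = (\<integral>\<^sup>+ x. indicator ((A - B) \<union> (B - A)) x \<partial>M)"
      by simp
    also have "\<dots> \<le> (\<integral>\<^sup>+ x. D x y \<partial>M)"
      by (intro nn_integral_mono) (auto simp: D A_def B_def split: split_indicator)
    finally show ?thesis
      by (simp add: cdf)
  qed
  then have "L1_norm (\<lambda>y. upper_cdf (distr M borel F) y - upper_cdf (distr M borel G) y) \<le>
      (\<integral>\<^sup>+ y. \<integral>\<^sup>+ x. D x y \<partial>M \<partial>lborel)"
    unfolding L1_norm_def by (intro nn_integral_mono)
  also have "\<dots> = (\<integral>\<^sup>+ x. \<integral>\<^sup>+ y. D x y \<partial>lborel \<partial>M)"
    by (rule Fubini') measurable
  also have "\<dots> = (\<integral>\<^sup>+ x. ennreal \<bar>F x - G x\<bar> \<partial>M)"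
    by (intro nn_integral_cong) (auto simp: D_def max_def min_def)
  also have "\<dots> \<le> (\<integral>\<^sup>+ x. ennreal d \<partial>M)"
    using d by (intro nn_integral_mono ennreal_leI)
  also have "\<dots> = ennreal d"
    by (simp add: emeasure_space_1)
  finally show ?thesis .
qed

section \<open>Collocation error\<close>

lemma open_ellipse_open: "open_ellipse E \<Longrightarrow> open E"
  by (auto simp: open_ellipse_def intro!: open_Collect_less continuous_intros)

text \<open>A sublevel set of a sum of distances, which is a convex function. Convexity is what
  Cauchy's formula is applied with.\<close>

lemma open_ellipse_convex:
  assumes "open_ellipse E"
  shows "convex E"
proof -
  obtain a b r where E: "E = {z. dist z a + dist z b < r}"
    using assms by (auto simp: open_ellipse_def)
  have conv: "convex_on UNIV (\<lambda>z. dist a z + dist b z)"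
    by (intro convex_on_add convex_on_dist) auto
  show ?thesis
  proof (rule convexI)
    fix x y and u v :: real
    assume xy: "x \<in> E" "y \<in> E" and uv: "u \<ge> 0" "v \<ge> 0" "u + v = 1"
    have "dist a (u *\<^sub>R x + v *\<^sub>R y) + dist b (u *\<^sub>R x + v *\<^sub>R y) \<le>
        u * (dist a x + dist b x) + v * (dist a y + dist b y)"
      using conv uv by (auto simp: convex_on_def)
    also have "\<dots> < r"
      using xy uv by (intro convex_bound_lt) (auto simp: E dist_commute)
    finally show "u *\<^sub>R x + v *\<^sub>R y \<in> E"
      by (simp add: E dist_commute)
  qed
qed

text \<open>At the nodes \<open>g\<close> equals \<open>h\<close>, so \<open>g - q\<close> is at
  most \<open>e\<close> there; quadrature bounds its mean square and the Nikolskii inequality its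
  maximum.\<close>

lemma (in jacobi_polys) collocation_error:
  obtains C k where "C > 0"
    "\<And>N h g q e x. N \<ge> 1 \<Longrightarrow> collocation_gPC P h N g \<Longrightarrow> degree q \<le> N - 1 \<Longrightarrow>
       (\<And>x. x \<in> {-1..1} \<Longrightarrow> \<bar>h x - poly q x\<bar> \<le> e) \<Longrightarrow> x \<in> {-1..1} \<Longrightarrow>
       \<bar>h x - poly g x\<bar> \<le> (1 + C * real N ^ k) * e"
proof -
  obtain C k where C: "C > 0" and nik: "\<And>n (h :: real poly) x. n \<ge> 1 \<Longrightarrow> degree h \<le> n \<Longrightarrow> x \<in> {-1..1} \<Longrightarrow>
       (poly h x)\<^sup>2 \<le> C * real n ^ k * (LINT t|\<rho>. (poly h t)\<^sup>2)"
    by (rule nikolskii_jacobi[OF \<beta>]) blast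
  \<comment> \<open>Being at least 1, \<open>D * real N ^ k\<close> is at most its own square, so
    the square root of the bound can be taken without leaving integer powers.\<close>
  define D where "D = max 1 C"
  have "\<bar>h x - poly g x\<bar> \<le> (1 + D * real N ^ k) * e"
    if N: "N \<ge> 1" and g: "collocation_gPC P h N g" and q: "degree q \<le> N - 1"
      and e: "\<And>x. x \<in> {-1..1} \<Longrightarrow> \<bar>h x - poly q x\<bar> \<le> e" and x: "x \<in> {-1..1}"
    for N h g q e x
  proof -
    have e0: "e \<ge> 0" using e[OF x] by linarith
    have deg: "degree (g - q) \<le> N - 1"
      using g q by (intro degree_diff_le) (auto simp: collocation_gPC_def)
    have "\<bar>poly (g - q) a\<bar> \<le> e" if a: "a \<in> quadrature_points P N" for a
      using e[of a] g a quadrature_points_subset[of N] by (auto simp: collocation_gPC_def)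
    then have "I ((g - q)\<^sup>2) \<le> e\<^sup>2"
      by (rule I_square_le[OF N deg])
    then have "(LINT t|\<rho>. (poly (g - q) t)\<^sup>2) \<le> e\<^sup>2"
      by (simp add: I_def)
    then have "C * real N ^ k * (LINT t|\<rho>. (poly (g - q) t)\<^sup>2) \<le> C * real N ^ k * e\<^sup>2"
      using C by (intro mult_left_mono) auto
    \<comment> \<open>The degree bound is taken as N instead of N - 1, since it has to be at least 1
      even for N = 1.\<close>
    moreover have "(poly (g - q) x)\<^sup>2 \<le> C * real N ^ k * (LINT t|\<rho>. (poly (g - q) t)\<^sup>2)"
      using deg N x by (intro nik) auto
    moreover have "C * real N ^ k * e\<^sup>2 \<le> (D * real N ^ k)\<^sup>2 * e\<^sup>2"
    proof (rule mult_right_mono)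
      have "1 * 1 \<le> D * real N ^ k"
        using N by (intro mult_mono) (auto simp: D_def)
      then have "D * real N ^ k \<le> (D * real N ^ k)\<^sup>2"
        by (simp add: self_le_power)
      moreover have "C * real N ^ k \<le> D * real N ^ k"
        by (intro mult_right_mono) (auto simp: D_def)
      ultimately show "C * real N ^ k \<le> (D * real N ^ k)\<^sup>2" by linarith
    qed simp
    ultimately have "(poly (g - q) x)\<^sup>2 \<le> (D * real N ^ k * e)\<^sup>2"
      by (simp only: power_mult_distrib)
    then have "\<bar>poly (g - q) x\<bar> \<le> \<bar>D * real N ^ k * e\<bar>"
      by (rule abs_le_square_iff[THEN iffD2])
    also have "\<dots> = D * real N ^ k * e"
      using e0 by (simp add: D_def)
    finally have "\<bar>poly (g - q) x\<bar> \<le> D * real N ^ k * e" .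
    moreover have "\<bar>h x - poly g x\<bar> \<le> \<bar>h x - poly q x\<bar> + \<bar>poly (g - q) x\<bar>"
      by simp
    ultimately show ?thesis
      using e[OF x] by (simp add: algebra_simps)
  qed
  moreover have "D > 0" by (simp add: D_def)
  ultimately show thesis using that by blast
qed

text \<open>Half of the rate \<open>ln R\<close> absorbs the polynomial factor, the other half
  remains as \<gamma>.\<close>

lemma exp_dominates_power:
  fixes R :: real
  assumes "R > 1" "A > 0"
  obtains C \<gamma> where "C > 0" "\<gamma> > 0" "\<forall>\<^sub>F N in sequentially. (1 + A * real N ^ k) / R ^ N \<le> C * exp (- \<gamma> * real N)"
proof -
  define \<gamma> where "\<gamma> = ln R / 2"
  have \<gamma>: "\<gamma> > 0" using assms by (simp add: \<gamma>_def)
  have "(\<lambda>N. (1 + A * real N ^ k) * exp (- \<gamma> * real N)) \<longlonglongrightarrow> 0"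
    using \<gamma> by real_asymp
  then have "\<forall>\<^sub>F N in sequentially. (1 + A * real N ^ k) * exp (- \<gamma> * real N) < 1"
    by (rule order_tendstoD) simp
  then have "\<forall>\<^sub>F N in sequentially. (1 + A * real N ^ k) / R ^ N \<le> 1 * exp (- \<gamma> * real N)"
  proof eventually_elim
    case (elim N)
    have "R ^ N = exp (ln R * real N)"
      using assms by (simp add: exp_of_nat2_mult)
    also have "\<dots> = exp (\<gamma> * real N) * exp (\<gamma> * real N)"
      by (simp add: \<gamma>_def flip: exp_add)
    finally have "(1 + A * real N ^ k) / R ^ N = (1 + A * real N ^ k) * exp (- \<gamma> * real N) * exp (- \<gamma> * real N)"
      by (simp add: exp_minus field_simps)
    also have "\<dots> \<le> 1 * exp (- \<gamma> * real N)"
      using elim by (intro mult_right_mono) auto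
    finally show ?case .
  qed
  with that \<gamma> show thesis by (metis zero_less_one)
qed

theorem theorem7:
  fixes \<beta>\<^sub>1 \<beta>\<^sub>2 :: real
    and E :: "complex set"
    and f :: "complex \<Rightarrow> complex"
    and P :: "nat \<Rightarrow> real poly"
    and g :: "nat \<Rightarrow> real poly"
  defines "\<rho> \<equiv> jacobi_measure \<beta>\<^sub>1 \<beta>\<^sub>2"
    and "f\<^sub>r \<equiv> (\<lambda>x::real. Re (f (complex_of_real x)))"
  defines "\<mu> \<equiv> distr \<rho> borel f\<^sub>r"
    and "\<nu> \<equiv> (\<lambda>N. distr \<rho> borel (poly (g N)))"
  assumes "\<beta>\<^sub>1 > -1" and "\<beta>\<^sub>2 > -1"
    and "open_ellipse E"
    and "complex_of_real ` {-1..1} \<subseteq> E"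
    and "f analytic_on E"
    and "\<And>x::real. x \<in> {-1..1} \<Longrightarrow> f (complex_of_real x) \<in> \<real>"
    and "orthonormal_polys \<rho> P"
    and "\<And>N. N \<ge> 1 \<Longrightarrow> collocation_gPC P f\<^sub>r N (g N)"
  shows "\<forall>p::real. p \<ge> 1 \<longrightarrow> (\<exists>C>0. \<exists>\<gamma>>0. \<forall>\<^sub>F N in sequentially.
           wasserstein p \<mu> (\<nu> N) \<le> ennreal (C * exp (- \<gamma> * real N)) \<and>
           L1_norm (\<lambda>y. upper_cdf \<mu> y - upper_cdf (\<nu> N) y) \<le> ennreal (C * exp (- \<gamma> * real N)))"
proof -
  have \<beta>: "\<beta>\<^sub>1 > -1" "\<beta>\<^sub>2 > -1" by fact+
  interpret jacobi_polys \<beta>\<^sub>1 \<beta>\<^sub>2 P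
    by unfold_locales (use assms in auto)
  have E: "open_ellipse E" and ES: "complex_of_real ` {-1..1} \<subseteq> E" by fact+
  have f: "f holomorphic_on E"
    using \<open>f analytic_on E\<close> by (rule analytic_imp_holomorphic)
  have cont: "continuous_on {-1..1} f\<^sub>r"
  proof -
    have "continuous_on {-1..1} (\<lambda>x. f (complex_of_real x))"
      by (rule continuous_on_compose2[OF holomorphic_on_imp_continuous_on[OF f]])
        (intro continuous_intros, rule ES)
    then show ?thesis
      unfolding f\<^sub>r_def by (rule continuous_on_Re)
  qed
  have gN: "collocation_gPC P f\<^sub>r N (g N)" if "N \<ge> 1" for N
    using that by fact
  obtain C R where C: "C > 0" and R: "R > 1" and approx:
    "\<And>n. n \<ge> 1 \<Longrightarrow> \<exists>q :: real poly. degree q \<le> n - 1 \<and> (\<forall>x\<in>{-1..1}. \<bar>f\<^sub>r x - poly q x\<bar> \<le> C / R ^ n)"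
    unfolding f\<^sub>r_def
    by (rule exponential_polynomial_approximation[OF open_ellipse_open[OF E] open_ellipse_convex[OF E] ES f]) blast
  obtain A k where A: "A > 0" and colloc:
    "\<And>N h g q e x. N \<ge> 1 \<Longrightarrow> collocation_gPC P h N g \<Longrightarrow> degree q \<le> N - 1 \<Longrightarrow>
       (\<And>x. x \<in> {-1..1} \<Longrightarrow> \<bar>h x - poly q x\<bar> \<le> e) \<Longrightarrow> x \<in> {-1..1} \<Longrightarrow>
       \<bar>h x - poly g x\<bar> \<le> (1 + A * real N ^ k) * e"
    by (rule collocation_error) blast
  obtain B \<gamma> where B: "B > 0" "\<gamma> > 0"
    and ev: "\<forall>\<^sub>F N in sequentially. (1 + A * real N ^ k) / R ^ N \<le> B * exp (- \<gamma> * real N)"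
    using exp_dominates_power[OF R A] .
  \<comment> \<open>The uniform error bound is settled before \<open>p\<close> is fixed, so the same
    constants serve every \<open>p\<close> and both distances.\<close>
  have bound: "\<forall>\<^sub>F N in sequentially. \<forall>x\<in>{-1..1}. \<bar>f\<^sub>r x - poly (g N) x\<bar> \<le> C * B * exp (- \<gamma> * real N)"
    using ev eventually_ge_at_top[of 1]
  proof eventually_elim
    case (elim N)
    obtain q where q: "degree q \<le> N - 1" "\<And>x. x \<in> {-1..1} \<Longrightarrow> \<bar>f\<^sub>r x - poly q x\<bar> \<le> C / R ^ N"
      using approx[OF elim(2)] by blast
    show ?case
    proof
      fix x :: real assume "x \<in> {-1..1}"
      then have "\<bar>f\<^sub>r x - poly (g N) x\<bar> \<le> (1 + A * real N ^ k) * (C / R ^ N)"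
        using elim(2) gN q by (intro colloc) auto
      also have "\<dots> = C * ((1 + A * real N ^ k) / R ^ N)"
        by simp
      also have "\<dots> \<le> C * (B * exp (- \<gamma> * real N))"
        using C elim(1) by (intro mult_left_mono) auto
      finally show "\<bar>f\<^sub>r x - poly (g N) x\<bar> \<le> C * B * exp (- \<gamma> * real N)"
        by (simp add: mult.assoc)
    qed
  qed
  have meas: "f\<^sub>r \<in> borel_measurable \<rho>" "poly (g N) \<in> borel_measurable \<rho>" for N
    unfolding \<rho>_def by (intro borel_measurable_jacobi_measure cont continuous_intros)+
  show ?thesis
  proof (intro allI impI)
    fix p :: real assume p: "p \<ge> 1"
    have "\<forall>\<^sub>F N in sequentially.
        wasserstein p \<mu> (\<nu> N) \<le> ennreal (C * B * exp (- \<gamma> * real N)) \<and>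
        L1_norm (\<lambda>y. upper_cdf \<mu> y - upper_cdf (\<nu> N) y) \<le> ennreal (C * B * exp (- \<gamma> * real N))"
      using bound
    proof eventually_elim
      case (elim N)
      then show ?case
        unfolding \<mu>_def \<nu>_def \<rho>_def
        using meas(1) meas(2)[of N] p B C
        by (intro conjI wasserstein_distr_le L1_norm_upper_cdf_distr_le) (auto simp: \<rho>_def)
    qed
    then show "\<exists>C>0. \<exists>\<gamma>>0. \<forall>\<^sub>F N in sequentially.
        wasserstein p \<mu> (\<nu> N) \<le> ennreal (C * exp (- \<gamma> * real N)) \<and>
        L1_norm (\<lambda>y. upper_cdf \<mu> y - upper_cdf (\<nu> N) y) \<le> ennreal (C * exp (- \<gamma> * real N))"
      using B C by (intro exI[of _ "C * B"] exI[of _ \<gamma>] conjI mult_pos_pos)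
  qed
qed

end
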